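(* Let $$H_2^{*}(t)=2^7\prod_{n=1}^{\infty}\left(\frac{1+t^{2n-1}}{1-t^{2n-1}}\right)^{16}=\sum_{n=0}^{\infty}h^{*}_{2,n}t^n,$$ a power series with nonnegative coefficients and radius of convergence $R=1$. Then $H_2^{*}(t)$ satisfies the strong Gaussian condition, i.e. $$\lim_{t\to 1^-}\int_{-\pi\sigma(t)}^{\pi\sigma(t)}\left|E[e^{i\theta Z(t)}]-e^{-\theta^2/2}\right|d\theta=0,$$ where $X_t$, $m(t)$, $\sigma(t)$, $Z(t)$ are associated to $F=H_2^{*}$ as described in the context.
   Context: For a power series $F(t)=\sum_{n\ge0}f_nt^n$ with real coefficients $f_n\ge0$ and radius of convergence $R$, and for each $t\in(0,R)$, let $X_t$ be a $\mathbb{Z}_{\ge0}$-valued random variable with $P[X_t=n]=f_nt^n/F(t)$. Let $m(t)=E[X_t]$ (equivalently $m(t)=t\frac{d}{dt}\log F(t)$), $\sigma^2(t)=E[(X_t-m(t))^2]$ (equivalently $\sigma^2(t)=t\frac{d}{dt}m(t)$), with $\sigma(t)>0$, and $Z(t)=(X_t-m(t))/\sigma(t)$. The series $F$ is said to satisfy the strong Gaussian condition if $\lim_{t\to R}\int_{-\pi\sigma(t)}^{\pi\sigma(t)}|E[e^{i\theta Z(t)}]-e^{-\theta^2/2}|\,d\theta=0$. Note $E[e^{i\theta X_t}]=F(e^{i\theta}t)/F(t)$. *)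

theory Defs
  imports "HOL-Probability.Probability" "HOL-Analysis.FPS_Convergence"
begin

text \<open>For a real power series \<open>F(t) = (\<Sum>n. f\<^sub>n t^n)\<close> with non-negative coefficients, the law of
  the random variable \<open>X\<^sub>t\<close>.  It is meaningful for \<open>F \<noteq> 0\<close> and \<open>t\<close> strictly between 0 and the
  radius of convergence; only the law of \<open>X\<^sub>t\<close> matters, so the underlying probability space is
  taken to be the naturals themselves.\<close>

definition X_pmf :: "real fps \<Rightarrow> real \<Rightarrow> nat pmf" where
  "X_pmf F t = embed_pmf (\<lambda>n. fps_nth F n * t ^ n / eval_fps F t)"

definition mean :: "real fps \<Rightarrow> real \<Rightarrow> real" where
  "mean F t = measure_pmf.expectation (X_pmf F t) real"

definition sigma :: "real fps \<Rightarrow> real \<Rightarrow> real" where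
  "sigma F t = sqrt (measure_pmf.expectation (X_pmf F t) (\<lambda>n. (real n - mean F t)\<^sup>2))"

definition Z :: "real fps \<Rightarrow> real \<Rightarrow> nat \<Rightarrow> real" where
  "Z F t n = (real n - mean F t) / sigma F t"

definition char_Z :: "real fps \<Rightarrow> real \<Rightarrow> real \<Rightarrow> complex" where
  "char_Z F t \<theta> = measure_pmf.expectation (X_pmf F t) (\<lambda>n. exp (\<i> * of_real (\<theta> * Z F t n)))"

text \<open>The radius of convergence is an extended real; the limit \<open>t \<rightarrow> R\<close> is taken from the left,
  which for \<open>R = \<infinity>\<close> means \<open>t \<rightarrow> \<infinity>\<close>.\<close>

definition to_radius :: "real fps \<Rightarrow> real filter" where
  "to_radius F = (if fps_conv_radius F = \<infinity> then at_top
                  else at_left (real_of_ereal (fps_conv_radius F)))"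

text \<open>The standing assumptions on \<open>F\<close> (non-negative coefficients, positive radius of convergence,
  \<open>\<sigma>(t) > 0\<close>) are part of the condition.\<close>

definition strong_gaussian :: "real fps \<Rightarrow> bool" where
  "strong_gaussian F \<longleftrightarrow>
     F \<noteq> 0 \<and> (\<forall>n. fps_nth F n \<ge> 0) \<and> fps_conv_radius F > 0 \<and>
     (\<forall>t. 0 < t \<and> ereal t < fps_conv_radius F \<longrightarrow> sigma F t > 0) \<and>
     ((\<lambda>t. integral {- pi * sigma F t .. pi * sigma F t}
             (\<lambda>\<theta>. cmod (char_Z F t \<theta> - of_real (exp (- (\<theta>\<^sup>2 / 2)))))) \<longlongrightarrow> 0) (to_radius F)"

text \<open>The infinite product is taken in the ring of formal power series with its \<open>t\<close>-adic metric;
  the index is shifted to start at 0, so the exponents \<open>2n - 1\<close> for \<open>n \<ge> 1\<close> become \<open>2n + 1\<close>.\<close>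

definition H2star :: "real fps" where
  "H2star = 2 ^ 7 * (\<Prod>n. ((1 + fps_X ^ (2 * n + 1)) / (1 - fps_X ^ (2 * n + 1))) ^ 16)"

end

theory Submission
  imports Defs
begin

text \<open>
  Writing \<open>H2star = 2\<^sup>7 exp G\<close> with \<open>G = \<Sum> g\<^sub>m t\<^sup>m\<close>, where \<open>g\<^sub>m = 32 \<Sum>\<^bsub>j | m\<^esub> 1/j\<close> for odd \<open>m\<close> and
  \<open>g\<^sub>m = 0\<close> otherwise, exhibits \<open>X\<^sub>t\<close> as a compound Poisson variable: its \<open>p\<close>-th cumulant is
  \<open>\<Sum> m\<^sup>p g\<^sub>m t\<^sup>m\<close>, which is \<open>O((1 - t)\<^bsup>-p-1\<^esup>)\<close>, and \<open>|E exp(iuX\<^sub>t)| = exp(- \<Sum> g\<^sub>m t\<^sup>m (1 - cos um))\<close>.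
  Since \<open>g\<^sub>m \<ge> 32\<close> for odd \<open>m\<close>, the exponent is bounded below by a geometric series with an explicit
  value, which shows that \<open>\<sigma>\<^sup>2\<close> has exact order \<open>(1 - t)\<^bsup>-3\<^esup>\<close> and gives, uniformly in \<open>|\<theta>| \<le> \<pi>\<sigma>\<close>, a Gaussian
  bound for the characteristic function of \<open>Z\<close> up to the char_error \<open>(1 - t)\<^sup>3 = o(1/\<sigma>)\<close>. The third cumulant is
  \<open>o(\<sigma>\<^sup>3)\<close>, so the characteristic function converges pointwise, and dominated convergence applies.
\<close>

section \<open>Formal power series with real coefficients\<close>

text \<open>The characteristic function needs the series at complex points
  \<open>t * iexp u\<close>, the moments need it at real \<open>t\<close>. A polymorphic target lets
  each evaluation lemma be proved once for both; on the reals the embedding is the identity.\<close>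

definition fps_embed :: "real fps \<Rightarrow> 'a::real_normed_field fps" where
  "fps_embed F = Abs_fps (\<lambda>n. of_real (fps_nth F n))"

lemma fps_embed_nth [simp]: "fps_nth (fps_embed F) n = of_real (fps_nth F n)"
  by (simp add: fps_embed_def)

lemma fps_embed_real [simp]: "fps_embed F = (F :: real fps)"
  by (simp add: fps_eq_iff)

lemma fps_embed_1 [simp]: "fps_embed 1 = 1"
  by (simp add: fps_eq_iff)

lemma fps_embed_add: "fps_embed (F + G) = fps_embed F + fps_embed G"
  by (simp add: fps_eq_iff)

lemma fps_embed_diff: "fps_embed (F - G) = fps_embed F - fps_embed G"
  by (simp add: fps_eq_iff)

lemma fps_embed_mult: "fps_embed (F * G) = fps_embed F * fps_embed G"
  by (simp add: fps_eq_iff fps_mult_nth)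

lemma fps_embed_X_power [simp]: "fps_embed (fps_X ^ k) = fps_X ^ k"
  by (simp add: fps_eq_iff fps_X_power_nth)

lemma fps_embed_power: "fps_embed (F ^ k) = fps_embed F ^ k"
  by (induction k) (simp_all add: fps_embed_mult)

lemma fps_conv_radius_embed [simp]:
  "fps_conv_radius (fps_embed F :: 'a::{banach, real_normed_field} fps) = fps_conv_radius F"
proof -
  have "conv_radius (\<lambda>n. of_real (fps_nth F n) :: 'a) = conv_radius (fps_nth F)"
    unfolding conv_radius_def by simp
  then show ?thesis
    by (simp add: fps_conv_radius_def fps_embed_def)
qed

lemma fps_conv_radius_ge_1I:
  fixes F :: "'a::{banach, real_normed_field} fps"
  assumes "\<And>t::real. 0 < t \<Longrightarrow> t < 1 \<Longrightarrow> summable (\<lambda>n. norm (fps_nth F n) * t ^ n)"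
  shows "fps_conv_radius F \<ge> 1"
  unfolding fps_conv_radius_def
proof (rule conv_radius_geI_ex')
  fix r :: real assume r: "0 < r" "ereal r < 1"
  then have "r < 1" by (simp add: one_ereal_def)
  then have "summable (\<lambda>n. norm (fps_nth F n * of_real r ^ n))"
    using assms[of r] r by (simp add: norm_mult norm_power)
  then show "summable (\<lambda>n. fps_nth F n * of_real r ^ n)"
    by (rule summable_norm_cancel)
qed

text \<open>In the t-adic metric convergence means that each coefficient is eventually constant. The
  coefficients of \<open>G\<close> dominate, so Tannery's theorem exchanges limit and sum. This is
  the bridge from formal limits to limits of functions, used for the product and for its
  logarithm.\<close>

lemma eval_fps_tannery:
  fixes F :: "nat \<Rightarrow> real fps" and z :: "'a::{banach, real_normed_field}"
  assumes lim: "F \<longlonglongrightarrow> G"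
    and bound: "\<And>N k. \<bar>fps_nth (F N) k\<bar> \<le> fps_nth G k"
    and z: "ereal (norm z) < fps_conv_radius G"
  shows "(\<lambda>N. eval_fps (fps_embed (F N)) z) \<longlonglongrightarrow> eval_fps (fps_embed G) z"
proof -
  have nn: "fps_nth G k \<ge> 0" for k
    using bound[of 0 k] by linarith
  have "summable (\<lambda>n. norm (fps_nth G n * norm z ^ n))"
    by (rule norm_summable_fps) (use z in simp)
  then have s: "summable (\<lambda>n. fps_nth G n * norm z ^ n)"
    by (rule summable_norm_cancel)
  have "((\<lambda>N. \<Sum>k. fps_nth (fps_embed (F N)) k * z ^ k) \<longlongrightarrow>
      (\<Sum>k. fps_nth (fps_embed G) k * z ^ k)) sequentially"
  proof (rule tannerys_theorem[THEN conjunct2, THEN conjunct2])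
    show "((\<lambda>N. fps_nth (fps_embed (F N)) k * z ^ k) \<longlongrightarrow> fps_nth (fps_embed G) k * z ^ k) sequentially" for k
    proof (rule tendsto_eventually)
      have "eventually (\<lambda>N. fps_nth (F N) k = fps_nth G k) sequentially"
        using lim by (simp add: tendsto_fps_iff)
      then show "eventually (\<lambda>N. fps_nth (fps_embed (F N)) k * z ^ k = fps_nth (fps_embed G) k * z ^ k) sequentially"
        by eventually_elim simp
    qed
    show "\<forall>\<^sub>F (k, N) in sequentially \<times>\<^sub>F sequentially.
        norm (fps_nth (fps_embed (F N)) k * z ^ k) \<le> fps_nth G k * norm z ^ k"
      by (rule always_eventually)
        (auto simp: norm_mult norm_power intro!: mult_right_mono bound)
  qed (use s in auto)
  then show ?thesis
    by (simp add: eval_fps_def)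
qed

text \<open>Here \<open>B\<close> is 1 modulo \<open>t^(m+1)\<close>. This makes the partial
  products stabilise: factor number \<open>n\<close> differs from 1 only from degree
  \<open>2n+1\<close> on.\<close>

lemma fps_mult_nth_eq_left:
  fixes A B :: "'a::comm_ring_1 fps"
  assumes "fps_nth B 0 = 1" and "\<And>k. 0 < k \<Longrightarrow> k \<le> m \<Longrightarrow> fps_nth B k = 0"
  shows "fps_nth (A * B) m = fps_nth A m"
proof -
  have "fps_nth (A * B) m = (\<Sum>i=0..m. fps_nth A i * fps_nth B (m - i))"
    by (simp add: fps_mult_nth)
  also have "\<dots> = (\<Sum>i\<in>{m}. fps_nth A i * fps_nth B (m - i))"
    by (rule sum.mono_neutral_right) (auto simp: assms(2))
  finally show ?thesis
    by (simp add: assms(1))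
qed

lemma fps_mult_nonneg:
  fixes A B :: "real fps"
  assumes "\<And>n. fps_nth A n \<ge> 0" "\<And>n. fps_nth B n \<ge> 0"
  shows "fps_nth (A * B) n \<ge> 0"
  by (auto simp: fps_mult_nth assms intro!: sum_nonneg mult_nonneg_nonneg)

lemma fps_mult_nth_ge_left:
  fixes A B :: "real fps"
  assumes "\<And>n. fps_nth A n \<ge> 0" "\<And>n. fps_nth B n \<ge> 0" "fps_nth B 0 \<ge> 1"
  shows "fps_nth (A * B) n \<ge> fps_nth A n"
proof -
  have "fps_nth A n * 1 \<le> fps_nth A n * fps_nth B (n - n)"
    using assms by (intro mult_left_mono) auto
  also have "\<dots> \<le> (\<Sum>i=0..n. fps_nth A i * fps_nth B (n - i))"
    by (rule member_le_sum[of n "{0..n}" "\<lambda>i. fps_nth A i * fps_nth B (n - i)"]) (auto simp: assms)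
  finally show ?thesis
    by (simp add: fps_mult_nth)
qed

lemma fps_power_nonneg:
  fixes A :: "real fps"
  assumes "\<And>n. fps_nth A n \<ge> 0"
  shows "fps_nth (A ^ k) n \<ge> 0"
  by (induction k arbitrary: n) (auto intro: fps_mult_nonneg assms)

lemma fps_prod_nonneg:
  fixes f :: "'b \<Rightarrow> real fps"
  assumes "\<And>i n. fps_nth (f i) n \<ge> 0"
  shows "fps_nth (\<Prod>i\<in>A. f i) n \<ge> 0"
  by (induction A arbitrary: n rule: infinite_finite_induct) (auto intro: fps_mult_nonneg assms)

section \<open>The factors, the partial products and their t-adic limit\<close>

definition geom_quot :: "nat \<Rightarrow> real fps" where
  "geom_quot k = (1 + fps_X ^ k) / (1 - fps_X ^ k)"

lemma geom_quot_nth: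
  assumes "k > 0"
  shows "fps_nth (geom_quot k) m = (if m = 0 then 1 else if k dvd m then 2 else 0)"
proof -
  define Q :: "real fps" where "Q = Abs_fps (\<lambda>m. if m = 0 then 1 else if k dvd m then 2 else 0)"
  have "Q * (1 - fps_X ^ k) = 1 + fps_X ^ k"
  proof (rule fps_ext)
    fix m
    show "fps_nth (Q * (1 - fps_X ^ k)) m = fps_nth (1 + fps_X ^ k) m"
      using assms
      by (auto simp: algebra_simps fps_X_power_mult_nth fps_X_power_mult_right_nth fps_X_power_nth Q_def dvd_minus_self dest: dvd_imp_le)
  qed
  moreover have "fps_nth (1 - fps_X ^ k :: real fps) 0 \<noteq> 0"
    using assms by (simp add: fps_X_power_nth)
  then have "(1 - fps_X ^ k :: real fps) \<noteq> 0"
    by (metis fps_zero_nth)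
  ultimately have "geom_quot k = Q"
    unfolding geom_quot_def by (metis nonzero_mult_div_cancel_right)
  then show ?thesis
    by (simp add: Q_def)
qed

lemma geom_quot_mult:
  assumes "k > 0"
  shows "geom_quot k * (1 - fps_X ^ k) = 1 + fps_X ^ k"
proof (rule fps_ext)
  fix m
  show "fps_nth (geom_quot k * (1 - fps_X ^ k)) m = fps_nth (1 + fps_X ^ k) m"
    using assms
    by (auto simp: algebra_simps fps_X_power_mult_nth fps_X_power_mult_right_nth fps_X_power_nth geom_quot_nth dvd_minus_self dest: dvd_imp_le)
qed

lemma fps_conv_radius_geom_quot:
  assumes "k > 0"
  shows "fps_conv_radius (geom_quot k) \<ge> 1"
proof (rule fps_conv_radius_ge_1I)
  fix t :: real assume "0 < t" "t < 1"
  then have "summable (\<lambda>n. 2 * t ^ n)"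
    by (intro summable_mult summable_geometric) auto
  then show "summable (\<lambda>n. norm (fps_nth (geom_quot k) n) * t ^ n)"
    by (rule summable_comparison_test'[where N = 0]) (use assms \<open>0 < t\<close> in \<open>auto simp: geom_quot_nth\<close>)
qed

lemma one_minus_power_neq_0:
  fixes z :: "'a::real_normed_field"
  assumes "norm z < 1" "k > 0"
  shows "1 - z ^ k \<noteq> 0"
proof
  assume "1 - z ^ k = 0"
  then have "norm z ^ k = 1"
    by (metis eq_iff_diff_eq_0 norm_one norm_power)
  then show False
    using assms power_less_one_iff[of "norm z" k] by simp
qed

lemma eval_fps_geom_quot:
  fixes z :: "'a::{banach, real_normed_field}"
  assumes "k > 0" "norm z < 1"
  shows "eval_fps (fps_embed (geom_quot k)) z = (1 + z ^ k) / (1 - z ^ k)"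
proof -
  have r: "ereal (norm z) < fps_conv_radius (fps_embed (geom_quot k) :: 'a fps)"
    using fps_conv_radius_geom_quot[OF assms(1)] assms(2)
    by (simp add: less_le_trans[of _ 1] one_ereal_def)
  have e: "eval_fps (1 - fps_X ^ k) z = 1 - z ^ k" "eval_fps (1 + fps_X ^ k) z = 1 + z ^ k"
    by (subst eval_fps_diff eval_fps_add; simp)+
  have rd: "ereal (norm z) < fps_conv_radius (1 - fps_X ^ k :: 'a fps)"
    using fps_conv_radius_diff[of "1 :: 'a fps" "fps_X ^ k"] by simp
  have "fps_embed (geom_quot k) * (1 - fps_X ^ k) = (1 + fps_X ^ k :: 'a fps)"
    using arg_cong[OF geom_quot_mult[OF assms(1)], of fps_embed]
    by (simp add: fps_embed_mult fps_embed_add fps_embed_diff)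
  then have "eval_fps (fps_embed (geom_quot k)) z * (1 - z ^ k) = 1 + z ^ k"
    using eval_fps_mult[OF r rd] by (simp add: e)
  then show ?thesis
    using one_minus_power_neq_0[OF assms(2,1)] by (simp add: field_simps)
qed

definition geom_factor :: "nat \<Rightarrow> real fps" where
  "geom_factor n = geom_quot (2 * n + 1) ^ 16"

definition partial_prod :: "nat \<Rightarrow> real fps" where
  "partial_prod N = (\<Prod>n\<le>N. geom_factor n)"

lemma geom_factor_nonneg: "fps_nth (geom_factor n) k \<ge> 0"
  unfolding geom_factor_def by (rule fps_power_nonneg) (simp add: geom_quot_nth)

lemma fps_power_nth_initial:
  fixes B :: "'a::comm_ring_1 fps"
  assumes "fps_nth B 0 = 1" "\<And>k. 0 < k \<Longrightarrow> k \<le> m \<Longrightarrow> fps_nth B k = 0"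
  shows "fps_nth (B ^ p) m = fps_nth 1 m"
proof (induction p)
  case (Suc p)
  have "fps_nth (B ^ Suc p) m = fps_nth (B ^ p * B) m"
    by (simp add: mult.commute)
  also have "\<dots> = fps_nth (B ^ p) m"
    by (rule fps_mult_nth_eq_left) (use assms in auto)
  finally show ?case
    using Suc by simp
qed auto

lemma geom_factor_nth_initial:
  assumes "m \<le> 2 * n"
  shows "fps_nth (geom_factor n) m = (if m = 0 then 1 else 0)"
  unfolding geom_factor_def
  by (subst fps_power_nth_initial) (use assms in \<open>auto simp: geom_quot_nth dest: dvd_imp_le\<close>)

lemma partial_prod_Suc: "partial_prod (Suc N) = partial_prod N * geom_factor (Suc N)"
  by (simp add: partial_prod_def)

lemma partial_prod_nonneg: "fps_nth (partial_prod N) k \<ge> 0"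
  unfolding partial_prod_def by (rule fps_prod_nonneg) (rule geom_factor_nonneg)

lemma partial_prod_nth_mono: "M \<le> N \<Longrightarrow> fps_nth (partial_prod M) k \<le> fps_nth (partial_prod N) k"
proof (induction N rule: dec_induct)
  case (step N)
  have "fps_nth (partial_prod N) k \<le> fps_nth (partial_prod (Suc N)) k"
    unfolding partial_prod_Suc
    by (rule fps_mult_nth_ge_left) (auto simp: partial_prod_nonneg geom_factor_nonneg geom_factor_nth_initial)
  with step show ?case by simp
qed simp

lemma partial_prod_nth_stable: "k \<le> N \<Longrightarrow> fps_nth (partial_prod N) k = fps_nth (partial_prod k) k"
proof (induction N rule: dec_induct)
  case (step N)
  have "fps_nth (partial_prod (Suc N)) k = fps_nth (partial_prod N) k"
    unfolding partial_prod_Suc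
    by (rule fps_mult_nth_eq_left) (use step in \<open>auto simp: geom_factor_nth_initial\<close>)
  with step show ?case by simp
qed simp

definition full_prod :: "real fps" where
  "full_prod = Abs_fps (\<lambda>k. fps_nth (partial_prod k) k)"

lemma partial_prod_tendsto: "partial_prod \<longlonglongrightarrow> full_prod"
proof (rule tendsto_fpsI)
  show "\<forall>\<^sub>F N in sequentially. fps_nth (partial_prod N) n = fps_nth full_prod n" for n
    using eventually_ge_at_top[of n] 
    by eventually_elim (unfold full_prod_def fps_nth_Abs_fps, rule partial_prod_nth_stable)
qed

lemma partial_prod_le_full_prod: "fps_nth (partial_prod N) k \<le> fps_nth full_prod k"
proof (cases "k \<le> N")
  case True
  then have "fps_nth (partial_prod N) k = fps_nth full_prod k"
    unfolding full_prod_def fps_nth_Abs_fps by (rule partial_prod_nth_stable)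
  then show ?thesis by simp
next
  case False
  then show ?thesis by (simp add: full_prod_def partial_prod_nth_mono)
qed

text \<open>A single factor \<open>(1+t)/(1-t)\<close> has coefficients 1, 2, 2, ..., and
  multiplying by series with nonnegative coefficients and constant term 1 lowers nothing. The
  resulting bound keeps the coefficients of the product away from 0, which limits its radius of
  convergence.\<close>

lemma geom_quot_le_partial_prod: "fps_nth (geom_quot 1) k \<le> fps_nth (partial_prod N) k"
proof -
  have "geom_factor 0 = geom_quot 1 * geom_quot 1 ^ 15"
    by (simp add: geom_factor_def flip: power_Suc)
  moreover have "fps_nth (geom_quot 1 ^ 15) 0 = 1"
    by (subst fps_power_nth_initial) (auto simp: geom_quot_nth)
  ultimately have "fps_nth (geom_quot 1) k \<le> fps_nth (geom_factor 0) k"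
    by (simp only:) (rule fps_mult_nth_ge_left; auto simp: geom_quot_nth intro!: fps_power_nonneg)
  also have "geom_factor 0 = partial_prod 0"
    by (simp add: partial_prod_def)
  also have "fps_nth (partial_prod 0) k \<le> fps_nth (partial_prod N) k"
    by (rule partial_prod_nth_mono) simp
  finally show ?thesis .
qed

lemma full_prod_nth_ge_1: "fps_nth full_prod k \<ge> 1"
  using geom_quot_le_partial_prod[of k 0] partial_prod_le_full_prod[of 0 k] by (simp add: geom_quot_nth split: if_splits)

lemma H2star_eq: "H2star = fps_const 128 * full_prod"
proof -
  \<comment> \<open>\<open>has_prod\<close> demands a nonzero limit when no factor vanishes; the
    constant coefficient of \<open>full_prod\<close> provides it.\<close>
  have "geom_factor has_prod full_prod"
    unfolding has_prod_def raw_has_prod_def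
    using partial_prod_tendsto full_prod_nth_ge_1[of 0] by (auto simp: partial_prod_def[abs_def])
  then have "full_prod = prodinf geom_factor"
    by (rule has_prod_unique)
  then show ?thesis
    unfolding H2star_def by (simp add: geom_factor_def[abs_def] geom_quot_def numeral_fps_const)
qed

section \<open>The logarithm of the product\<close>

lemma power_le_fact_mult_exp:
  fixes x :: real
  assumes "x \<ge> 0"
  shows "x ^ p \<le> fact p * exp x"
proof -
  have "x ^ p /\<^sub>R fact p = (\<Sum>n\<in>{p}. x ^ n /\<^sub>R fact n)"
    by simp
  also have "\<dots> \<le> exp x"
    unfolding exp_def
    by (rule sum_le_suminf) (use assms summable_exp_generic[of x] in auto)
  finally show ?thesis
    by (simp add: field_simps)
qed

text \<open>Split \<open>exp (-y) ^ i\<close> into \<open>q ^ i * q ^ i\<close> with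
  \<open>q = exp (-y/2)\<close>: one half absorbs the power \<open>i ^ p\<close>, the other is
  summed as a geometric series of value at most \<open>q / (1 - q) \<le> 2 / y\<close>.\<close>

lemma sum_power_exp_le:
  fixes y :: real
  assumes "y > 0"
  shows "(\<Sum>i=1..M. real i ^ p * exp (- y) ^ i) \<le> 2 ^ (p + 1) * fact p / y ^ (p + 1)"
proof -
  define q where "q = exp (- y / 2)"
  have q: "0 < q" "q < 1"
    using assms by (auto simp: q_def)
  have *: "real i ^ p * exp (- y) ^ i \<le> 2 ^ p * fact p / y ^ p * q ^ i" for i
  proof -
    have e: "exp (y * real i / 2) * q ^ i = 1" "exp (- y) ^ i = q ^ i * q ^ i"
      by (simp_all add: q_def flip: exp_of_nat_mult exp_add)
    have "(y * real i / 2) ^ p \<le> fact p * exp (y * real i / 2)"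
      by (rule power_le_fact_mult_exp) (use assms in auto)
    then have "(y * real i / 2) ^ p * (q ^ i * q ^ i) \<le> fact p * exp (y * real i / 2) * (q ^ i * q ^ i)"
      using q by (intro mult_right_mono) auto
    also have "\<dots> = fact p * q ^ i"
      using e(1) by simp
    finally show ?thesis
      using assms unfolding e(2) by (simp add: field_simps power_mult_distrib power_divide)
  qed
  have "(\<Sum>i=1..M. real i ^ p * exp (- y) ^ i) \<le> (\<Sum>i=1..M. 2 ^ p * fact p / y ^ p * q ^ i)"
    by (intro sum_mono *)
  also have "\<dots> = 2 ^ p * fact p / y ^ p * (\<Sum>i=1..M. q ^ i)"
    by (simp add: sum_distrib_left)
  also have "\<dots> \<le> 2 ^ p * fact p / y ^ p * (2 / y)"
  proof (rule mult_left_mono)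
    have "(\<Sum>i=1..M. q ^ i) \<le> q / (1 - q)"
    proof -
      have "(\<Sum>i=1..M. q ^ i) = q * (\<Sum>i<M. q ^ i)"
        by (simp add: sum_distrib_left sum.atLeast1_atMost_eq)
      also have "\<dots> = q * ((1 - q ^ M) / (1 - q))"
        using q by (simp add: sum_gp_strict)
      also have "\<dots> \<le> q * (1 / (1 - q))"
        using q by (intro mult_left_mono divide_right_mono) auto
      finally show ?thesis by simp
    qed
    also have "q / (1 - q) \<le> 2 / y"
    proof -
      have "1 + y / 2 \<le> exp (y / 2)"
        by (rule exp_ge_add_one_self)
      then have "q * (1 + y / 2) \<le> q * exp (y / 2)"
        using q by (intro mult_left_mono) auto
      also have "\<dots> = 1"
        by (simp add: q_def flip: exp_add)
      finally show ?thesis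
        using q assms by (simp add: field_simps)
    qed
    finally show "(\<Sum>i=1..M. q ^ i) \<le> 2 / y" .
  qed (use assms in simp)
  finally show ?thesis
    by (simp add: mult_ac)
qed

text \<open>Telescoping with \<open>1/(n+1)^2 \<le> 1/n - 1/(n+1)\<close>; the sharper bound
  \<open>2 - 1/n\<close> is what the induction carries.\<close>

lemma sum_inverse_squares_le: "(\<Sum>j=1..M. 1 / real j ^ 2) \<le> 2"
proof -
  have "(\<Sum>j=1..Suc M. 1 / real j ^ 2) \<le> 2 - 1 / real (Suc M)" for M
  proof (induction M)
    case (Suc M)
    have "1 / real (Suc (Suc M)) ^ 2 \<le> 1 / (real (Suc M) * real (Suc (Suc M)))"
      by (intro divide_left_mono) (auto simp: power2_eq_square)
    also have "\<dots> = 1 / real (Suc M) - 1 / real (Suc (Suc M))"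
      by (simp add: field_simps)
    finally show ?case
      using Suc by simp
  qed simp
  from this[of "M - 1"] show ?thesis
    by (cases M) (auto intro: order.trans)
qed

section \<open>Coefficients of the logarithm and bounds for their moments\<close>

text \<open>The series of \<open>artanh (t\<^sup>k)\<close> for \<open>k = 2n + 1\<close>: the coefficient \<open>1/j\<close> at \<open>m = kj\<close> is \<open>k/m\<close>.\<close>

definition log_layer :: "nat \<Rightarrow> real fps" where
  "log_layer n = Abs_fps (\<lambda>m. if odd m \<and> (2 * n + 1) dvd m then real (2 * n + 1) / real m else 0)"

text \<open>Since \<open>(1+x)/(1-x) = exp (2 artanh x)\<close> and every factor is raised to the
  power 16, each layer enters with weight 32.\<close>

definition log_partial :: "nat \<Rightarrow> real fps" where
  "log_partial N = fps_const 32 * (\<Sum>n\<le>N. log_layer n)"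

definition log_full :: "real fps" where
  "log_full = Abs_fps (\<lambda>m. fps_nth (log_partial m) m)"

lemma log_layer_nonneg: "fps_nth (log_layer n) m \<ge> 0"
  by (simp add: log_layer_def)

lemma log_partial_nth: "fps_nth (log_partial N) m = 32 * (\<Sum>n\<le>N. fps_nth (log_layer n) m)"
  by (simp add: log_partial_def fps_sum_nth)

lemma log_partial_nonneg: "fps_nth (log_partial N) m \<ge> 0"
  by (simp add: log_partial_nth sum_nonneg log_layer_nonneg)

lemma log_partial_mono: "M \<le> N \<Longrightarrow> fps_nth (log_partial M) m \<le> fps_nth (log_partial N) m"
  unfolding log_partial_nth by (intro mult_left_mono sum_mono2) (auto simp: log_layer_nonneg)

text \<open>A layer \<open>n > m\<close> contributes nothing at \<open>m\<close>, because
  \<open>2n+1\<close> would have to divide an odd, hence positive, number smaller than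
  itself.\<close>

lemma log_partial_stable:
  assumes "m \<le> N"
  shows "fps_nth (log_partial N) m = fps_nth log_full m"
proof -
  have "(\<Sum>n\<le>N. fps_nth (log_layer n) m) = (\<Sum>n\<le>m. fps_nth (log_layer n) m)"
    using assms by (intro sum.mono_neutral_right) (auto simp: log_layer_def dest!: dvd_imp_le intro: odd_pos)
  then show ?thesis
    by (simp add: log_full_def log_partial_nth)
qed

lemma log_full_nonneg: "fps_nth log_full m \<ge> 0"
  by (simp add: log_full_def log_partial_nonneg)

lemma log_partial_le: "fps_nth (log_partial N) m \<le> fps_nth log_full m"
  using log_partial_mono[of N "max N m" m] log_partial_stable[of m "max N m"] by simp

lemma log_partial_tendsto: "log_partial \<longlonglongrightarrow> log_full"
proof (rule tendsto_fpsI)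
  show "\<forall>\<^sub>F N in sequentially. fps_nth (log_partial N) n = fps_nth log_full n" for n
    using eventually_ge_at_top[of n] by eventually_elim (rule log_partial_stable)
qed

lemma log_full_nth_le:
  assumes "m > 0" "m \<le> M"
  shows "fps_nth log_full m \<le> 32 * (\<Sum>j | j \<in> {1..M} \<and> j dvd m. 1 / real j)"
proof -
  have "(\<Sum>n\<le>m. fps_nth (log_layer n) m) \<le> (\<Sum>n | n \<in> {..m} \<and> (2 * n + 1) dvd m. real (2 * n + 1) / real m)"
    by (subst sum.inter_filter) (auto simp: log_layer_def intro!: sum_mono)
  also have "\<dots> = (\<Sum>k\<in>(\<lambda>n. 2 * n + 1) ` {n. n \<in> {..m} \<and> (2 * n + 1) dvd m}. real k / real m)"
    by (subst sum.reindex) (auto simp: inj_on_def)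
  also have "\<dots> \<le> (\<Sum>k | k dvd m. real k / real m)"
    using assms by (intro sum_mono2) auto
  also have "\<dots> = (\<Sum>j | j dvd m. 1 / real j)"
    \<comment> \<open>Passing from a divisor \<open>k\<close> to its cofactor
      \<open>j = m div k\<close> turns \<open>k/m\<close> into \<open>1/j\<close>.\<close>
    by (rule sum.reindex_bij_witness[of _ "\<lambda>k. m div k" "\<lambda>k. m div k"])
      (use assms in \<open>auto simp: real_of_nat_div field_simps elim!: dvdE\<close>)
  also have "\<dots> \<le> (\<Sum>j | j \<in> {1..M} \<and> j dvd m. 1 / real j)"
  proof (intro sum_mono2)
    show "{j. j dvd m} \<subseteq> {j \<in> {1..M}. j dvd m}"
    proof
      fix j assume "j \<in> {j. j dvd m}"
      then have "j dvd m" "j \<le> m" "j \<noteq> 0"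
        using assms dvd_imp_le[of j m] by (auto intro!: Nat.gr0I)
      then show "j \<in> {j \<in> {1..M}. j dvd m}"
        using assms by auto
    qed
  qed auto
  finally show ?thesis
    by (simp add: log_full_def log_partial_nth)
qed

lemma log_full_0 [simp]: "fps_nth log_full 0 = 0"
  by (simp add: log_full_def log_partial_nth log_layer_def)

text \<open>Write \<open>m = j*i\<close> and sum over \<open>i\<close> first. With
  \<open>d = 1 - t\<close> and \<open>t \<le> exp (-d)\<close>, \<open>sum_power_exp_le\<close> at
  \<open>y = d*j\<close> bounds the inner sum, and the powers of \<open>j\<close> combine to
  \<open>j^(-1) * j^p * j^(-p-1) = j^(-2)\<close>, which is summable. The constant is
  \<open>32 * 2^(p+1) * 2 = 2^(p+7)\<close>.\<close>

lemma sum_moments_le: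
  fixes t :: real
  assumes "0 < t" "t < 1"
  shows "(\<Sum>m=1..M. real m ^ p * fps_nth log_full m * t ^ m) \<le> 2 ^ (p + 7) * fact p / (1 - t) ^ (p + 1)"
proof -
  define d where "d = 1 - t"
  have d: "d > 0" using assms by (simp add: d_def)
  have t_le: "t \<le> exp (- d)"
    using exp_ge_add_one_self[of "-d"] by (simp add: d_def)
  have "(\<Sum>m=1..M. real m ^ p * fps_nth log_full m * t ^ m) \<le>
      (\<Sum>m=1..M. real m ^ p * (32 * (\<Sum>j | j \<in> {1..M} \<and> j dvd m. 1 / real j)) * t ^ m)"
    using assms by (intro sum_mono mult_right_mono mult_left_mono log_full_nth_le) auto
  also have "\<dots> = (\<Sum>m=1..M. \<Sum>j | j \<in> {1..M} \<and> j dvd m. 32 / real j * (real m ^ p * t ^ m))"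
    by (simp add: sum_distrib_left sum_distrib_right mult_ac)
  also have "\<dots> = (\<Sum>j=1..M. \<Sum>m | m \<in> {1..M} \<and> j dvd m. 32 / real j * (real m ^ p * t ^ m))"
    by (rule sum.swap_restrict) auto
  also have "\<dots> \<le> (\<Sum>j=1..M. 2 ^ (p + 6) * fact p / d ^ (p + 1) * (1 / real j ^ 2))"
  proof (rule sum_mono)
    fix j assume j: "j \<in> {1..M}"
    \<comment> \<open>The multiples of \<open>j\<close> are allowed to run up to \<open>j*M\<close>
      instead of \<open>M\<close>; the added terms are nonnegative and the bound does not depend on
      the range.\<close>
    have "(\<Sum>m | m \<in> {1..M} \<and> j dvd m. real m ^ p * t ^ m) \<le> (\<Sum>m\<in>(*) j ` {1..M}. real m ^ p * t ^ m)"
    proof (rule sum_mono2)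
      show "{m \<in> {1..M}. j dvd m} \<subseteq> (*) j ` {1..M}"
      proof
        fix m assume "m \<in> {m \<in> {1..M}. j dvd m}"
        then obtain i where i: "m = j * i" "1 \<le> m" "m \<le> M"
          by (auto elim!: dvdE)
        have "i \<le> j * i" "i \<noteq> 0"
          using j i by auto
        then have "i \<le> M"
          using i by linarith
        with \<open>i \<noteq> 0\<close> have "i \<in> {1..M}"
          by simp
        then show "m \<in> (*) j ` {1..M}"
          using i(1) by blast
      qed
    qed (use assms in auto)
    also have "\<dots> = (\<Sum>i=1..M. real (j * i) ^ p * t ^ (j * i))"
      using j by (subst sum.reindex) (auto simp: inj_on_def)
    also have "\<dots> \<le> (\<Sum>i=1..M. real j ^ p * (real i ^ p * exp (- (d * real j)) ^ i))"
    proof (rule sum_mono)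
      fix i
      have "t ^ (j * i) \<le> exp (- d) ^ (j * i)"
        using t_le assms by (intro power_mono) auto
      also have "\<dots> = exp (- (d * real j)) ^ i"
        by (simp add: power_mult mult_ac flip: exp_of_nat_mult)
      finally show "real (j * i) ^ p * t ^ (j * i) \<le> real j ^ p * (real i ^ p * exp (- (d * real j)) ^ i)"
        by (simp add: power_mult_distrib mult_left_mono mult.assoc)
    qed
    also have "\<dots> = real j ^ p * (\<Sum>i=1..M. real i ^ p * exp (- (d * real j)) ^ i)"
      by (simp add: sum_distrib_left)
    also have "\<dots> \<le> real j ^ p * (2 ^ (p + 1) * fact p / (d * real j) ^ (p + 1))"
      using j d by (intro mult_left_mono sum_power_exp_le) auto
    finally have "32 / real j * (\<Sum>m | m \<in> {1..M} \<and> j dvd m. real m ^ p * t ^ m) \<le>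
        32 / real j * (real j ^ p * (2 ^ (p + 1) * fact p / (d * real j) ^ (p + 1)))"
      by (intro mult_left_mono) auto
    also have "\<dots> = 2 ^ (p + 6) * fact p / d ^ (p + 1) * (1 / real j ^ 2)"
      using j d by (simp add: field_simps power_mult_distrib power2_eq_square power_add)
    finally show "(\<Sum>m | m \<in> {1..M} \<and> j dvd m. 32 / real j * (real m ^ p * t ^ m)) \<le>
        2 ^ (p + 6) * fact p / d ^ (p + 1) * (1 / real j ^ 2)"
      by (simp add: sum_distrib_left)
  qed
  also have "\<dots> = 2 ^ (p + 6) * fact p / d ^ (p + 1) * (\<Sum>j=1..M. 1 / real j ^ 2)"
    by (simp add: sum_distrib_left)
  also have "\<dots> \<le> 2 ^ (p + 6) * fact p / d ^ (p + 1) * 2"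
    using d by (intro mult_left_mono sum_inverse_squares_le) auto
  also have "\<dots> = 2 ^ (p + 7) * fact p / d ^ (p + 1)"
    by (simp add: power_add)
  finally show ?thesis
    by (simp add: d_def)
qed

text \<open>For \<open>p = 0\<close> this is the value of \<open>log_full\<close> at
  \<open>t\<close>, whose convergence gives the radius; for \<open>p\<close> equal to 1, 2, 3 it is
  the corresponding cumulant of \<open>X_t\<close>.\<close>

definition cumulant :: "nat \<Rightarrow> real \<Rightarrow> real" where
  "cumulant p t = (\<Sum>m. real m ^ p * fps_nth log_full m * t ^ m)"

lemma cumulant_bound:
  assumes "0 < t" "t < 1"
  shows "summable (\<lambda>m. real m ^ p * fps_nth log_full m * t ^ m)" (is "summable ?f")
    and "cumulant p t \<le> 2 ^ (p + 7) * fact p / (1 - t) ^ (p + 1)"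
proof -
  have nn: "0 \<le> ?f m" for m
    using assms by (simp add: log_full_nonneg)
  have b: "(\<Sum>m<M. ?f m) \<le> 2 ^ (p + 7) * fact p / (1 - t) ^ (p + 1)" for M
  proof -
    have "(\<Sum>m<M. ?f m) \<le> (\<Sum>m\<in>insert 0 {1..M}. ?f m)"
      by (rule sum_mono2) (use nn in auto)
    also have "\<dots> = (\<Sum>m=1..M. ?f m)"
      by simp
    also have "\<dots> \<le> 2 ^ (p + 7) * fact p / (1 - t) ^ (p + 1)"
      by (rule sum_moments_le[OF assms])
    finally show ?thesis .
  qed
  show s: "summable ?f"
    by (rule summableI_nonneg_bounded[OF nn b])
  show "cumulant p t \<le> 2 ^ (p + 7) * fact p / (1 - t) ^ (p + 1)"
    unfolding cumulant_def by (rule suminf_le_const[OF s b])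
qed

lemma fps_conv_radius_log_full: "fps_conv_radius log_full \<ge> 1"
  by (rule fps_conv_radius_ge_1I) (use cumulant_bound(1)[of _ 0] in \<open>simp add: log_full_nonneg\<close>)

section \<open>Exponentiating the logarithm\<close>

text \<open>In the difference of the two logarithm series at \<open>z ^ k\<close> the even powers
  cancel and the odd ones double. The series in \<open>i\<close> is then spread out to
  \<open>m = k*i\<close>, the coefficients at all other \<open>m\<close> being 0.\<close>

lemma sums_log_layer:
  fixes z :: complex and n :: nat
  assumes "norm z < 1"
  defines "k \<equiv> 2 * n + 1"
  shows "(\<lambda>m. 2 * fps_nth (fps_embed (log_layer n)) m * z ^ m) sums (Ln (1 + z ^ k) - Ln (1 - z ^ k))"
proof -
  have w: "norm (z ^ k) < 1"
    unfolding norm_power using assms(1) power_less_one_iff[of "norm z" k] by (simp add: k_def)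
  \<comment> \<open>At \<open>i = 0\<close> both quotients have denominator 0 and so count as
    0.\<close>
  have "(\<lambda>i. - ((- (z ^ k)) ^ i) / of_nat i - - ((- (- (z ^ k))) ^ i) / of_nat i) sums
      (Ln (1 + z ^ k) - Ln (1 + - (z ^ k)))"
    by (intro sums_diff Ln_series') (use w in auto)
  also have "(\<lambda>i. - ((- (z ^ k)) ^ i) / of_nat i - - ((- (- (z ^ k))) ^ i) / of_nat i) =
      (\<lambda>i. 2 * fps_nth (fps_embed (log_layer n)) (k * i) * z ^ (k * i))"
  proof
    fix i
    show "- ((- (z ^ k)) ^ i) / of_nat i - - ((- (- (z ^ k))) ^ i) / of_nat i =
      2 * fps_nth (fps_embed (log_layer n)) (k * i) * z ^ (k * i)"
    proof (cases "even i")
      case True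
      then show ?thesis
        by (simp add: log_layer_def k_def)
    next
      case False
      moreover have "odd (k * i)" "k > 0"
        using False by (simp_all add: k_def)
      moreover have "i > 0"
        using False by (auto intro: Nat.gr0I)
      ultimately have "fps_nth (log_layer n) (k * i) = 1 / real i"
        unfolding log_layer_def k_def[symmetric] by (simp add: field_simps)
      then show ?thesis
        using False by (simp add: power_mult)
    qed
  qed
  finally have "(\<lambda>i. 2 * fps_nth (fps_embed (log_layer n)) (k * i) * z ^ (k * i)) sums
      (Ln (1 + z ^ k) - Ln (1 - z ^ k))" by simp
  then show ?thesis
  proof (subst (asm) sums_mono_reindex[of "\<lambda>i. k * i" "\<lambda>m. 2 * fps_nth (fps_embed (log_layer n)) m * z ^ m"])
    show "strict_mono ((*) k)"
      by (rule strict_monoI) (auto simp: k_def intro!: mult_strict_left_mono simp del: mult_Suc)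
    show "2 * fps_nth (fps_embed (log_layer n)) m * z ^ m = 0" if "m \<notin> range ((*) k)" for m
    proof -
      have "\<not> k dvd m"
        using that by (auto elim!: dvdE)
      then show ?thesis
        by (simp add: log_layer_def k_def)
    qed
  qed
qed

lemma exp_eval_log_layer:
  fixes z :: complex
  assumes "norm z < 1"
  shows "(\<lambda>m. fps_nth (fps_embed (log_layer n)) m * z ^ m) sums eval_fps (fps_embed (log_layer n)) z"
    and "exp (2 * eval_fps (fps_embed (log_layer n)) z) = eval_fps (fps_embed (geom_quot (2 * n + 1))) z"
proof -
  define k where "k = 2 * n + 1"
  have s: "(\<lambda>m. fps_nth (fps_embed (log_layer n)) m * z ^ m) sums ((Ln (1 + z ^ k) - Ln (1 - z ^ k)) / 2)"
    using sums_divide[OF sums_log_layer[OF assms, of n], of 2] by (simp add: k_def)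
  then show "(\<lambda>m. fps_nth (fps_embed (log_layer n)) m * z ^ m) sums eval_fps (fps_embed (log_layer n)) z"
    unfolding eval_fps_def by (simp add: sums_iff)
  have e: "eval_fps (fps_embed (log_layer n)) z = (Ln (1 + z ^ k) - Ln (1 - z ^ k)) / 2"
    using s unfolding eval_fps_def by (simp add: sums_iff)
  \<comment> \<open>As \<open>k\<close> is odd, \<open>1 + z ^ k\<close> is
    \<open>1 - (- z) ^ k\<close>, so one lemma covers both.\<close>
  have "1 - z ^ k \<noteq> 0" "1 - (- z) ^ k \<noteq> 0"
    by (rule one_minus_power_neq_0; use assms in \<open>simp add: k_def\<close>)+
  then have "1 - z ^ k \<noteq> 0" "1 + z ^ k \<noteq> 0"
    by (auto simp: k_def)
  moreover have "2 * eval_fps (fps_embed (log_layer n)) z = Ln (1 + z ^ k) - Ln (1 - z ^ k)"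
    using e by (simp add: field_simps)
  ultimately have "exp (2 * eval_fps (fps_embed (log_layer n)) z) = (1 + z ^ k) / (1 - z ^ k)"
    by (simp only: exp_diff exp_Ln not_False_eq_True)
  then show "exp (2 * eval_fps (fps_embed (log_layer n)) z) = eval_fps (fps_embed (geom_quot (2 * n + 1))) z"
    using assms by (simp add: eval_fps_geom_quot k_def)
qed

lemma eval_log_partial:
  fixes z :: complex
  assumes "norm z < 1"
  shows "eval_fps (fps_embed (log_partial N)) z = (\<Sum>n\<le>N. 32 * eval_fps (fps_embed (log_layer n)) z)"
proof -
  have "(\<lambda>m. \<Sum>n\<le>N. 32 * (fps_nth (fps_embed (log_layer n)) m * z ^ m)) sums
      (\<Sum>n\<le>N. 32 * eval_fps (fps_embed (log_layer n)) z)"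
    by (intro sums_sum sums_mult exp_eval_log_layer assms)
  then show ?thesis
    unfolding eval_fps_def by (simp add: sums_iff log_partial_nth sum_distrib_left sum_distrib_right mult_ac)
qed

lemma eval_partial_prod:
  fixes z :: "'a::{banach, real_normed_field}"
  assumes "norm z < 1"
  shows "eval_fps (fps_embed (partial_prod N)) z = (\<Prod>n\<le>N. ((1 + z ^ (2 * n + 1)) / (1 - z ^ (2 * n + 1))) ^ 16)"
    and "fps_conv_radius (partial_prod N) \<ge> 1"
proof -
  have r: "fps_conv_radius (geom_factor n) \<ge> 1" for n
    unfolding geom_factor_def using fps_conv_radius_power[of "geom_quot (2 * n + 1)" 16] fps_conv_radius_geom_quot[of "2 * n + 1"]
    by (simp add: order.trans)
  have lt: "ereal (norm z) < fps_conv_radius F" if "fps_conv_radius F \<ge> 1" for F :: "real fps"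
    using that assms by (simp add: less_le_trans[of _ 1] one_ereal_def)
  have e: "eval_fps (fps_embed (geom_factor n)) z = ((1 + z ^ (2 * n + 1)) / (1 - z ^ (2 * n + 1))) ^ 16" for n
    unfolding geom_factor_def fps_embed_power
    by (subst eval_fps_power; (subst eval_fps_geom_quot)?)
      (use assms in \<open>auto intro!: lt fps_conv_radius_geom_quot\<close>)
  \<comment> \<open>Both claims go through one induction, because evaluation is multiplicative only
    inside the discs of convergence.\<close>
  have "eval_fps (fps_embed (partial_prod N)) z = (\<Prod>n\<le>N. ((1 + z ^ (2 * n + 1)) / (1 - z ^ (2 * n + 1))) ^ 16) \<and>
    fps_conv_radius (partial_prod N) \<ge> 1"
  proof (induction N)
    case 0
    show ?case using e[of 0] r[of 0] by (simp add: partial_prod_def)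
  next
    case (Suc N)
    have "eval_fps (fps_embed (partial_prod (Suc N))) z =
        eval_fps (fps_embed (partial_prod N)) z * eval_fps (fps_embed (geom_factor (Suc N))) z"
      unfolding partial_prod_Suc fps_embed_mult
      by (rule eval_fps_mult) (use Suc r in \<open>auto intro!: lt\<close>)
    moreover have "fps_conv_radius (partial_prod (Suc N)) \<ge> 1"
      unfolding partial_prod_Suc using fps_conv_radius_mult[of "partial_prod N" "geom_factor (Suc N)"] Suc r[of "Suc N"]
      by (meson min.boundedI order.trans)
    ultimately show ?case
      using Suc e[of "Suc N"] by simp
  qed
  then show "eval_fps (fps_embed (partial_prod N)) z = (\<Prod>n\<le>N. ((1 + z ^ (2 * n + 1)) / (1 - z ^ (2 * n + 1))) ^ 16)"
    and "fps_conv_radius (partial_prod N) \<ge> 1" by auto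
qed

section \<open>The law of \<open>X\<^sub>t\<close> and its cumulants\<close>

lemma less_conv_radius:
  assumes "norm z < 1" "fps_conv_radius F \<ge> 1"
  shows "ereal (norm z) < fps_conv_radius F"
  using assms by (simp add: less_le_trans[of _ 1] one_ereal_def)

lemma eval_fps_embed_of_real:
  fixes t :: real
  assumes "\<bar>t\<bar> < 1" "fps_conv_radius F \<ge> 1"
  shows "eval_fps (fps_embed F) (of_real t :: 'a::{banach, real_normed_field}) = of_real (eval_fps F t)"
proof -
  have "(\<lambda>n. fps_nth F n * t ^ n) sums eval_fps F t"
    by (rule sums_eval_fps) (use assms less_conv_radius[of t F] in simp)
  then have "(\<lambda>n. of_real (fps_nth F n * t ^ n) :: 'a) sums of_real (eval_fps F t)"
    by (simp only: sums_of_real_iff)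
  then show ?thesis
    unfolding eval_fps_def by (simp add: sums_iff)
qed

lemma fps_conv_radius_log_partial: "fps_conv_radius (log_partial N) \<ge> 1"
proof (rule fps_conv_radius_ge_1I)
  fix t :: real assume t: "0 < t" "t < 1"
  have "summable (\<lambda>n. fps_nth log_full n * t ^ n)"
    using cumulant_bound(1)[OF t, of 0] by simp
  then show "summable (\<lambda>n. norm (fps_nth (log_partial N) n) * t ^ n)"
    by (rule summable_comparison_test'[where N = 0])
      (use t in \<open>auto simp: log_partial_nonneg intro!: mult_right_mono log_partial_le\<close>)
qed

lemma eval_partial_prod_exp:
  fixes z :: complex
  assumes "norm z < 1"
  shows "eval_fps (fps_embed (partial_prod N)) z = exp (eval_fps (fps_embed (log_partial N)) z)"
proof -
  have "exp (32 * eval_fps (fps_embed (log_layer n)) z) = ((1 + z ^ (2 * n + 1)) / (1 - z ^ (2 * n + 1))) ^ 16" for n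
  proof -
    have "exp (32 * eval_fps (fps_embed (log_layer n)) z) = exp (2 * eval_fps (fps_embed (log_layer n)) z) ^ 16"
      by (simp flip: exp_of_nat_mult)
    then show ?thesis
      by (simp only: exp_eval_log_layer[OF assms]) (subst eval_fps_geom_quot; use assms in simp)
  qed
  then show ?thesis
    by (simp only: eval_partial_prod(1)[OF assms] eval_log_partial[OF assms] exp_sum finite_atMost)
qed

text \<open>The right-hand side is free of \<open>N\<close>; this uniform bound is what makes the
  limit series converge. The identity with the exponential is obtained in the complex plane and read
  back on the reals.\<close>

lemma eval_partial_prod_le:
  fixes t :: real
  assumes "0 < t" "t < 1"
  shows "eval_fps (partial_prod N) t \<le> exp (eval_fps log_full t)"
proof -
  have "complex_of_real (eval_fps (partial_prod N) t) = complex_of_real (exp (eval_fps (log_partial N) t))"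
    using eval_partial_prod_exp[of "of_real t" N] assms
    by (simp add: eval_fps_embed_of_real eval_partial_prod(2)[of t] fps_conv_radius_log_partial exp_of_real)
  then have "eval_fps (partial_prod N) t = exp (eval_fps (log_partial N) t)"
    by (simp only: of_real_eq_iff)
  also have "eval_fps (log_partial N) t \<le> eval_fps log_full t"
    unfolding eval_fps_def
    by (intro suminf_le summable_fps mult_right_mono log_partial_le less_conv_radius
        fps_conv_radius_log_partial fps_conv_radius_log_full) (use assms in auto)
  finally show ?thesis by simp
qed

text \<open>A larger radius would give convergence at 1, although the coefficients are at least 1.
  Conversely, the first \<open>K\<close> coefficients agree with those of
  \<open>partial_prod K\<close>, so every partial sum is at most a value of a finite product, which
  \<open>eval_partial_prod_le\<close> bounds.\<close>

lemma fps_conv_radius_full_prod: "fps_conv_radius full_prod = 1"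
proof (rule antisym)
  have "\<not> 1 < fps_conv_radius full_prod"
  proof
    assume "1 < fps_conv_radius full_prod"
    then have "summable (\<lambda>n. fps_nth full_prod n * 1 ^ n)"
      by (intro summable_fps) (simp add: one_ereal_def)
    then have "fps_nth full_prod \<longlonglongrightarrow> 0"
      using summable_LIMSEQ_zero by force
    then have "1 \<le> (0::real)"
      by (rule LIMSEQ_le_const) (use full_prod_nth_ge_1 in auto)
    then show False by simp
  qed
  then show "fps_conv_radius full_prod \<le> 1" by simp
  show "1 \<le> fps_conv_radius full_prod"
  proof (rule fps_conv_radius_ge_1I)
    fix t :: real assume t: "0 < t" "t < 1"
    have pos: "0 \<le> fps_nth full_prod n" for n
      using full_prod_nth_ge_1[of n] by simp
    show "summable (\<lambda>n. norm (fps_nth full_prod n) * t ^ n)"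
    proof (rule summableI_nonneg_bounded)
      fix K
      have "(\<Sum>n<K. norm (fps_nth full_prod n) * t ^ n) = (\<Sum>n<K. fps_nth (partial_prod K) n * t ^ n)"
        by (intro sum.cong) (use pos in \<open>auto simp: full_prod_def partial_prod_nth_stable[of _ K] less_imp_le\<close>)
      also have "\<dots> \<le> eval_fps (partial_prod K) t"
        unfolding eval_fps_def
        by (intro sum_le_suminf summable_fps less_conv_radius eval_partial_prod(2)[of t])
          (use t in \<open>auto simp: partial_prod_nonneg\<close>)
      also have "\<dots> \<le> exp (eval_fps log_full t)"
        by (rule eval_partial_prod_le[OF t])
      finally show "(\<Sum>n<K. norm (fps_nth full_prod n) * t ^ n) \<le> exp (eval_fps log_full t)" .
    qed (use t in auto)
  qed
qed

lemma eval_partial_prod_tendsto: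
  fixes z :: "'a::{banach, real_normed_field}"
  assumes "norm z < 1"
  shows "(\<lambda>N. eval_fps (fps_embed (partial_prod N)) z) \<longlonglongrightarrow> eval_fps (fps_embed full_prod) z"
  by (rule eval_fps_tannery[OF partial_prod_tendsto])
    (use assms in \<open>auto simp: partial_prod_nonneg partial_prod_le_full_prod fps_conv_radius_full_prod one_ereal_def\<close>)

lemma eval_full_prod:
  fixes z :: complex
  assumes "norm z < 1"
  shows "eval_fps (fps_embed full_prod) z = exp (eval_fps (fps_embed log_full) z)"
proof (rule LIMSEQ_unique)
  show "(\<lambda>N. eval_fps (fps_embed (partial_prod N)) z) \<longlonglongrightarrow> eval_fps (fps_embed full_prod) z"
    by (rule eval_partial_prod_tendsto[OF assms])
  have "(\<lambda>N. eval_fps (fps_embed (log_partial N)) z) \<longlonglongrightarrow> eval_fps (fps_embed log_full) z"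
    by (rule eval_fps_tannery[OF log_partial_tendsto])
      (use assms in \<open>auto simp: log_partial_nonneg log_partial_le less_conv_radius fps_conv_radius_log_full\<close>)
  then show "(\<lambda>N. eval_fps (fps_embed (partial_prod N)) z) \<longlonglongrightarrow> exp (eval_fps (fps_embed log_full) z)"
    by (simp only: eval_partial_prod_exp[OF assms] tendsto_exp)
qed

lemma eval_full_prod_real:
  fixes t :: real
  assumes "\<bar>t\<bar> < 1"
  shows "eval_fps full_prod t = exp (eval_fps log_full t)"
proof -
  have "complex_of_real (eval_fps full_prod t) = complex_of_real (exp (eval_fps log_full t))"
    using eval_full_prod[of "of_real t"] assms
    by (simp add: eval_fps_embed_of_real fps_conv_radius_full_prod fps_conv_radius_log_full exp_of_real)
  then show ?thesis
    by (simp only: of_real_eq_iff)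
qed

text \<open>\<open>full_prod\<close> is a t-adic limit; this identifies its values with a convergent
  product of real numbers. As with the formal product, \<open>has_prod\<close> needs a nonzero
  limit, here supplied by the exponential.\<close>

lemma eval_full_prod_eq_prodinf:
  fixes t :: real
  assumes "\<bar>t\<bar> < 1"
  shows "eval_fps full_prod t = (\<Prod>n. ((1 + t ^ (2 * n + 1)) / (1 - t ^ (2 * n + 1))) ^ 16)"
proof -
  have "(\<lambda>N. \<Prod>n\<le>N. ((1 + t ^ (2 * n + 1)) / (1 - t ^ (2 * n + 1))) ^ 16) \<longlonglongrightarrow> eval_fps full_prod t"
    using eval_partial_prod_tendsto[of t] eval_partial_prod(1)[of t] assms by simp
  moreover have "eval_fps full_prod t \<noteq> 0"
    by (simp add: eval_full_prod_real assms)
  ultimately have "(\<lambda>n. ((1 + t ^ (2 * n + 1)) / (1 - t ^ (2 * n + 1))) ^ 16) has_prod eval_fps full_prod t"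
    unfolding has_prod_def raw_has_prod_def by simp
  then show ?thesis
    by (rule has_prod_unique)
qed

section \<open>Logarithmic derivative and moments\<close>

text \<open>The formal identity \<open>F' = G' F\<close> is obtained analytically:
  \<open>F = exp G\<close> is differentiated on the complex unit disc, and two power series agreeing
  near 0 have equal coefficients. Injectivity of the embedding returns it to real series.\<close>

lemma fps_deriv_full_prod: "fps_deriv full_prod = fps_deriv log_full * full_prod"
proof -
  have embed_deriv: "fps_embed (fps_deriv F) = (fps_deriv (fps_embed F) :: complex fps)" for F
    by (simp add: fps_eq_iff)
  have r: "fps_conv_radius (fps_deriv (fps_embed full_prod) :: complex fps) \<ge> 1"
      "fps_conv_radius (fps_deriv (fps_embed log_full) :: complex fps) \<ge> 1"
    using fps_conv_radius_deriv[of "fps_embed full_prod :: complex fps"]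
      fps_conv_radius_deriv[of "fps_embed log_full :: complex fps"]
    by (auto simp: fps_conv_radius_full_prod intro: order.trans[OF fps_conv_radius_log_full])
  have rm: "fps_conv_radius (fps_deriv (fps_embed log_full) * fps_embed full_prod :: complex fps) \<ge> 1"
    using fps_conv_radius_mult[of "fps_deriv (fps_embed log_full) :: complex fps" "fps_embed full_prod"] r
    by (auto simp: fps_conv_radius_full_prod)
  have ev: "eval_fps (fps_deriv (fps_embed full_prod)) z = eval_fps (fps_deriv (fps_embed log_full) * fps_embed full_prod) z"
    if z: "norm z < 1" for z :: complex
  proof -
    have "((\<lambda>w. exp (eval_fps (fps_embed log_full) w)) has_field_derivative
        exp (eval_fps (fps_embed log_full) z) * eval_fps (fps_deriv (fps_embed log_full)) z) (at z)"
      by (intro DERIV_fun_exp has_field_derivative_eval_fps less_conv_radius z)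
        (simp add: fps_conv_radius_log_full)
    then have "(eval_fps (fps_embed full_prod) has_field_derivative
        exp (eval_fps (fps_embed log_full) z) * eval_fps (fps_deriv (fps_embed log_full)) z) (at z)"
      by (rule has_field_derivative_transform_within_open[where S = "ball 0 1"])
        (use z in \<open>auto simp: eval_full_prod\<close>)
    moreover have "(eval_fps (fps_embed full_prod) has_field_derivative eval_fps (fps_deriv (fps_embed full_prod)) z) (at z)"
      by (intro has_field_derivative_eval_fps less_conv_radius z) (simp add: fps_conv_radius_full_prod)
    ultimately have "eval_fps (fps_deriv (fps_embed full_prod)) z =
        exp (eval_fps (fps_embed log_full) z) * eval_fps (fps_deriv (fps_embed log_full)) z"
      using DERIV_unique by blast
    also have "\<dots> = eval_fps (fps_deriv (fps_embed log_full) * fps_embed full_prod) z"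
      by (subst eval_fps_mult)
        (use z r in \<open>auto simp: eval_full_prod less_conv_radius fps_conv_radius_full_prod one_ereal_def\<close>)
    finally show ?thesis .
  qed
  have "fps_deriv (fps_embed full_prod) = (fps_deriv (fps_embed log_full) * fps_embed full_prod :: complex fps)"
  proof (rule eval_fps_eqD)
    have "eventually (\<lambda>z::complex. z \<in> ball 0 1) (nhds 0)"
      by (intro eventually_nhds_in_open) auto
    then show "\<forall>\<^sub>F z in nhds 0. eval_fps (fps_deriv (fps_embed full_prod)) z =
        eval_fps (fps_deriv (fps_embed log_full) * fps_embed full_prod) (z :: complex)"
      by eventually_elim (rule ev, simp)
  qed (use r rm in \<open>auto intro: less_le_trans[of 0 1]\<close>)
  then have "(fps_embed (fps_deriv full_prod) :: complex fps) = fps_embed (fps_deriv log_full * full_prod)"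
    by (simp add: embed_deriv fps_embed_mult)
  then show ?thesis
    by (simp add: fps_eq_iff del: fps_deriv_nth flip: fps_embed_def)
qed

text \<open>Applied to a generating function, this operator produces the unnormalised
  moments.\<close>

definition euler :: "real fps \<Rightarrow> real fps" where
  "euler F = fps_X * fps_deriv F"

lemma euler_nth: "fps_nth (euler F) n = real n * fps_nth F n"
  by (cases n) (simp_all add: euler_def)

lemma euler_mult: "euler (F * G) = euler F * G + F * euler G"
  by (simp add: euler_def algebra_simps)

lemma fps_conv_radius_euler: "fps_conv_radius F \<ge> 1 \<Longrightarrow> fps_conv_radius (euler F) \<ge> 1"
  unfolding euler_def
  using fps_conv_radius_mult[of fps_X "fps_deriv F"] fps_conv_radius_deriv[of F]
  by (simp add: min_def)

lemma euler_full_prod: "euler full_prod = euler log_full * full_prod"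
  by (simp add: euler_def fps_deriv_full_prod mult.assoc)

text \<open>With \<open>F = exp G\<close> and \<open>E\<close> for \<open>euler\<close>, the product
  rule gives \<open>E F = (E G) F\<close> and \<open>E (E F) = (E (E G) + (E G)^2) F\<close>; the
  values of \<open>E G\<close> and \<open>E (E G)\<close> at \<open>t\<close> are the first two
  cumulants.\<close>

lemma euler_sums:
  fixes t :: real
  assumes "0 < t" "t < 1"
  shows "(\<lambda>n. fps_nth full_prod n * t ^ n) sums eval_fps full_prod t"
    and "(\<lambda>n. real n * fps_nth full_prod n * t ^ n) sums (cumulant 1 t * eval_fps full_prod t)"
    and "(\<lambda>n. real n ^ 2 * fps_nth full_prod n * t ^ n) sums ((cumulant 2 t + cumulant 1 t ^ 2) * eval_fps full_prod t)"
proof -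
  have r: "fps_conv_radius full_prod \<ge> 1" "fps_conv_radius log_full \<ge> 1"
    by (simp_all add: fps_conv_radius_full_prod fps_conv_radius_log_full)
  have t1: "norm t < 1" using assms by simp
  \<comment> \<open>Odd positions of the list concern \<open>full_prod\<close>, even ones
    \<open>log_full\<close>, after zero, one and two applications of \<open>euler\<close>.\<close>
  note R = r r[THEN fps_conv_radius_euler] r[THEN fps_conv_radius_euler, THEN fps_conv_radius_euler]
  note L = R[THEN less_conv_radius[OF t1]]
  show "(\<lambda>n. fps_nth full_prod n * t ^ n) sums eval_fps full_prod t"
    using L(1) by (rule sums_eval_fps)
  have c1: "eval_fps (euler log_full) t = cumulant 1 t"
    by (simp add: eval_fps_def euler_nth cumulant_def)
  have c2: "eval_fps (euler (euler log_full)) t = cumulant 2 t"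
    by (simp add: eval_fps_def euler_nth cumulant_def power2_eq_square mult_ac)
  have e1: "eval_fps (euler full_prod) t = cumulant 1 t * eval_fps full_prod t"
    unfolding euler_full_prod by (subst eval_fps_mult) (use L in \<open>auto simp: c1\<close>)
  show "(\<lambda>n. real n * fps_nth full_prod n * t ^ n) sums (cumulant 1 t * eval_fps full_prod t)"
    using sums_eval_fps[OF L(3)] by (simp add: euler_nth e1)
  have m: "ereal (norm t) < fps_conv_radius (euler (euler log_full) * full_prod)"
    "ereal (norm t) < fps_conv_radius (euler log_full * euler full_prod)"
    using L by (auto intro: less_le_trans[OF _ fps_conv_radius_mult])
  have "euler (euler full_prod) = euler (euler log_full) * full_prod + euler log_full * euler full_prod"
    by (simp add: euler_full_prod euler_mult)
  then have "eval_fps (euler (euler full_prod)) t =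
      eval_fps (euler (euler log_full)) t * eval_fps full_prod t + eval_fps (euler log_full) t * eval_fps (euler full_prod) t"
    using L m by (simp add: eval_fps_add eval_fps_mult)
  then have "eval_fps (euler (euler full_prod)) t = (cumulant 2 t + cumulant 1 t ^ 2) * eval_fps full_prod t"
    by (simp add: c1 c2 e1 algebra_simps power2_eq_square)
  then show "(\<lambda>n. real n ^ 2 * fps_nth full_prod n * t ^ n) sums ((cumulant 2 t + cumulant 1 t ^ 2) * eval_fps full_prod t)"
    using sums_eval_fps[OF L(5)] by (simp add: euler_nth power2_eq_square mult_ac)
qed

section \<open>Law, mean, variance and characteristic function\<close>

text \<open>The constant 128 cancels. \<open>embed_pmf\<close> returns the given weights only if
  they are nonnegative with total mass 1, and this is what has to be checked.\<close>

lemma pmf_X_H2star: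
  assumes "0 < t" "t < 1"
  shows "pmf (X_pmf H2star t) n = fps_nth full_prod n * t ^ n / eval_fps full_prod t"
proof -
  have pos: "eval_fps full_prod t > 0"
    using assms by (simp add: eval_full_prod_real)
  have F: "eval_fps H2star t = 128 * eval_fps full_prod t"
    unfolding H2star_eq using assms
    by (subst eval_fps_mult) (auto simp: fps_conv_radius_full_prod one_ereal_def)
  have eq: "(\<lambda>n. fps_nth H2star n * t ^ n / eval_fps H2star t) = (\<lambda>n. fps_nth full_prod n * t ^ n / eval_fps full_prod t)"
    by (simp add: F) (simp add: H2star_eq)
  have nn: "0 \<le> fps_nth full_prod n * t ^ n / eval_fps full_prod t" for n
    using full_prod_nth_ge_1[of n] pos assms by simp
  have "(\<lambda>n. fps_nth full_prod n * t ^ n / eval_fps full_prod t) sums (eval_fps full_prod t / eval_fps full_prod t)"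
    by (intro sums_divide euler_sums assms)
  then have "(\<integral>\<^sup>+n. ennreal (fps_nth full_prod n * t ^ n / eval_fps full_prod t) \<partial>count_space UNIV) = 1"
    unfolding nn_integral_count_space_nat using suminf_ennreal_eq[OF nn] pos by simp
  then show ?thesis
    unfolding X_pmf_def eq by (intro pmf_embed_pmf nn)
qed

lemma expectation_nat_pmf:
  fixes f :: "nat \<Rightarrow> 'b::{banach, second_countable_topology}"
  assumes "(\<lambda>n. pmf p n *\<^sub>R f n) sums s" "summable (\<lambda>n. norm (pmf p n *\<^sub>R f n))"
  shows "measure_pmf.expectation p f = s"
proof -
  have "measure_pmf.expectation p f = (LINT n|count_space UNIV. pmf p n *\<^sub>R f n)"
    unfolding measure_pmf_eq_density by (rule integral_density) auto
  also have "\<dots> = (\<Sum>n. pmf p n *\<^sub>R f n)"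
    by (rule integral_count_space_nat) (use assms in \<open>simp add: integrable_count_space_nat_iff\<close>)
  finally show ?thesis
    using assms by (simp add: sums_iff)
qed

lemma mean_H2star:
  assumes "0 < t" "t < 1"
  shows "mean H2star t = cumulant 1 t"
proof -
  have pos: "eval_fps full_prod t > 0"
    using assms by (simp add: eval_full_prod_real)
  have s: "(\<lambda>n. pmf (X_pmf H2star t) n *\<^sub>R real n) sums cumulant 1 t"
    using sums_divide[OF euler_sums(2)[OF assms], of "eval_fps full_prod t"] pos
    by (simp add: pmf_X_H2star assms mult_ac)
  show ?thesis
    unfolding mean_def
    by (rule expectation_nat_pmf[OF s]) (use s in \<open>simp add: sums_iff\<close>)
qed

lemma sigma_H2star:
  assumes "0 < t" "t < 1"
  shows "sigma H2star t = sqrt (cumulant 2 t)"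
proof -
  define F where "F = eval_fps full_prod t"
  have pos: "F > 0"
    using assms by (simp add: F_def eval_full_prod_real)
  define c where "c = cumulant 1 t"
  \<comment> \<open>The square is expanded and the three sums of \<open>euler_sums\<close> are
    combined; in the total the squares of the mean cancel.\<close>
  have "(\<lambda>n. real n ^ 2 * fps_nth full_prod n * t ^ n / F - 2 * c * (real n * fps_nth full_prod n * t ^ n / F)
      + c ^ 2 * (fps_nth full_prod n * t ^ n / F)) sums
      ((cumulant 2 t + cumulant 1 t ^ 2) * F / F - 2 * c * (cumulant 1 t * F / F) + c ^ 2 * (F / F))"
    unfolding F_def by (intro sums_add sums_diff sums_mult sums_divide euler_sums assms)
  also have "(\<lambda>n. real n ^ 2 * fps_nth full_prod n * t ^ n / F - 2 * c * (real n * fps_nth full_prod n * t ^ n / F)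
      + c ^ 2 * (fps_nth full_prod n * t ^ n / F)) = (\<lambda>n. pmf (X_pmf H2star t) n *\<^sub>R (real n - c)\<^sup>2)"
    by (simp add: fun_eq_iff pmf_X_H2star assms flip: F_def)
      (simp add: power2_eq_square algebra_simps diff_divide_distrib add_divide_distrib)
  also have "(cumulant 2 t + cumulant 1 t ^ 2) * F / F - 2 * c * (cumulant 1 t * F / F) + c ^ 2 * (F / F) = cumulant 2 t"
    using pos by (simp add: c_def power2_eq_square)
  finally have s: "(\<lambda>n. pmf (X_pmf H2star t) n *\<^sub>R (real n - c)\<^sup>2) sums cumulant 2 t" .
  then have "measure_pmf.expectation (X_pmf H2star t) (\<lambda>n. (real n - c)\<^sup>2) = cumulant 2 t"
    by (rule expectation_nat_pmf) (use s in \<open>simp add: sums_iff\<close>)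
  then show ?thesis
    by (simp add: sigma_def mean_H2star assms c_def)
qed

text \<open>\<open>E exp(iuX_t)\<close> is the quotient of the values at \<open>t e^(iu)\<close> and
  at \<open>t\<close>; since the series is an exponential, the quotient becomes a difference in the
  exponent. The last term comes from centring at the mean.\<close>

lemma char_Z_H2star:
  fixes \<theta> :: real
  assumes "0 < t" "t < 1"
  defines "u \<equiv> \<theta> / sigma H2star t"
  shows "char_Z H2star t \<theta> = exp (eval_fps (fps_embed log_full) (of_real t * iexp u)
      - of_real (eval_fps log_full t) - \<i> * of_real (u * cumulant 1 t))"
proof -
  define F where "F = eval_fps full_prod t"
  define z where "z = of_real t * iexp u"
  have z: "norm z < 1"
    using assms by (simp add: z_def norm_mult)
  have pos: "F > 0" and F: "F = exp (eval_fps log_full t)"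
    using assms by (simp_all add: F_def eval_full_prod_real)
  have iz: "exp (\<i> * of_real (\<theta> * Z H2star t n)) = exp (- (\<i> * of_real (u * cumulant 1 t))) * iexp u ^ n" for n
    by (simp add: Z_def mean_H2star assms u_def diff_divide_distrib algebra_simps flip: exp_of_nat_mult exp_add)
  have summand: "pmf (X_pmf H2star t) n *\<^sub>R exp (\<i> * of_real (\<theta> * Z H2star t n)) =
      exp (- (\<i> * of_real (u * cumulant 1 t))) * (fps_nth (fps_embed full_prod) n * z ^ n) / of_real F" for n
    unfolding iz by (simp add: pmf_X_H2star assms F_def scaleR_conv_of_real z_def power_mult_distrib)
  have "(\<lambda>n. fps_nth (fps_embed full_prod) n * z ^ n) sums eval_fps (fps_embed full_prod) z"
    by (rule sums_eval_fps) (use z in \<open>simp add: fps_conv_radius_full_prod one_ereal_def\<close>)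
  then have "(\<lambda>n. pmf (X_pmf H2star t) n *\<^sub>R exp (\<i> * of_real (\<theta> * Z H2star t n))) sums
     (exp (- (\<i> * of_real (u * cumulant 1 t))) * eval_fps (fps_embed full_prod) z / of_real F)"
    unfolding summand by (intro sums_divide sums_mult)
  moreover have "summable (\<lambda>n. norm (pmf (X_pmf H2star t) n *\<^sub>R exp (\<i> * of_real (\<theta> * Z H2star t n))))"
  proof -
    have "(\<lambda>n. fps_nth full_prod n * t ^ n / F) sums (F / F)"
      unfolding F_def by (intro sums_divide euler_sums assms)
    then have "summable (\<lambda>n. pmf (X_pmf H2star t) n)"
      unfolding pmf_X_H2star[OF assms(1,2)] F_def by (rule sums_summable)
    then show ?thesis
      by simp
  qed
  ultimately have "char_Z H2star t \<theta> =
      exp (- (\<i> * of_real (u * cumulant 1 t))) * eval_fps (fps_embed full_prod) z / of_real F"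
    unfolding char_Z_def by (rule expectation_nat_pmf)
  also have "\<dots> = exp (eval_fps (fps_embed log_full) z - of_real (eval_fps log_full t) - \<i> * of_real (u * cumulant 1 t))"
    by (simp add: eval_full_prod z F exp_diff exp_minus exp_add field_simps flip: exp_of_real)
  finally show ?thesis
    by (simp add: z_def)
qed

text \<open>The compound Poisson form of the exponent. Modulus and Taylor remainder of the
  characteristic function can now be estimated term by term.\<close>

lemma sums_log_char:
  fixes t u :: real
  assumes "0 < t" "t < 1"
  shows "(\<lambda>m. of_real (fps_nth log_full m * t ^ m) * (iexp (u * real m) - 1 - \<i> * of_real (u * real m))) sums
    (eval_fps (fps_embed log_full) (of_real t * iexp u) - of_real (eval_fps log_full t) - \<i> * of_real (u * cumulant 1 t))"
proof -
  define z where "z = of_real t * iexp u"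
  have z: "norm z < 1"
    using assms by (simp add: z_def norm_mult)
  have "(\<lambda>m. fps_nth (fps_embed log_full) m * z ^ m) sums eval_fps (fps_embed log_full) z"
    by (rule sums_eval_fps) (use z in \<open>auto intro!: less_conv_radius simp: fps_conv_radius_log_full\<close>)
  moreover have "(\<lambda>m. fps_nth log_full m * t ^ m) sums eval_fps log_full t"
    by (rule sums_eval_fps) (use assms less_conv_radius[of t, OF _ fps_conv_radius_log_full] in simp)
  then have "(\<lambda>m. of_real (fps_nth log_full m * t ^ m)) sums complex_of_real (eval_fps log_full t)"
    by (simp only: sums_of_real_iff)
  moreover have "(\<lambda>m. real m ^ 1 * fps_nth log_full m * t ^ m) sums cumulant 1 t"
    unfolding cumulant_def by (rule summable_sums[OF cumulant_bound(1)[OF assms]])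
  then have "(\<lambda>m. u * (real m ^ 1 * fps_nth log_full m * t ^ m)) sums (u * cumulant 1 t)"
    by (rule sums_mult)
  then have "(\<lambda>m. of_real (u * (real m ^ 1 * fps_nth log_full m * t ^ m))) sums complex_of_real (u * cumulant 1 t)"
    by (simp only: sums_of_real_iff)
  ultimately have "(\<lambda>m. fps_nth (fps_embed log_full) m * z ^ m - of_real (fps_nth log_full m * t ^ m) -
      \<i> * of_real (u * (real m ^ 1 * fps_nth log_full m * t ^ m))) sums
     (eval_fps (fps_embed log_full) z - of_real (eval_fps log_full t) - \<i> * of_real (u * cumulant 1 t))"
    by (intro sums_diff sums_mult)
  moreover have "z ^ m = of_real (t ^ m) * iexp (u * real m)" for m
    by (simp add: z_def power_mult_distrib mult_ac flip: exp_of_nat_mult)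
  ultimately show ?thesis
    by (simp add: algebra_simps flip: z_def)
qed

section \<open>Decay of the characteristic function\<close>

lemma abs_sin_ge_third:
  fixes u :: real
  assumes "\<bar>u\<bar> \<le> pi / 2"
  shows "\<bar>sin u\<bar> \<ge> \<bar>u\<bar> / 3"
proof -
  have "\<bar>sin u - (\<Sum>m<3. sin_coeff m * u ^ m)\<bar> \<le> inverse (fact 3) * \<bar>u\<bar> ^ 3"
    by (rule Maclaurin_sin_bound)
  then have "\<bar>sin u - u\<bar> \<le> \<bar>u\<bar> * (u ^ 2 / 6)"
    by (simp add: numeral_3_eq_3 sin_coeff_def power2_eq_square mult_ac)
  also have "\<dots> \<le> \<bar>u\<bar> * (2 / 3)"
  proof (rule mult_left_mono)
    have "\<bar>u\<bar> \<le> 2"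
      using assms pi_half_less_two by linarith
    then have "u ^ 2 \<le> 2 ^ 2"
      by (subst abs_le_square_iff[symmetric]) simp
    then show "u ^ 2 / 6 \<le> 2 / 3" by simp
  qed simp
  finally show ?thesis by linarith
qed

text \<open>The layer with \<open>2n+1 = m\<close> alone contributes 1, before the weight
  32.\<close>

lemma log_full_nth_ge:
  assumes "odd m"
  shows "fps_nth log_full m \<ge> 32"
proof -
  obtain n where n: "m = 2 * n + 1"
    using assms by (auto elim: oddE)
  have "(1::real) = fps_nth (log_layer n) m"
    using assms unfolding n by (simp add: log_layer_def)
  also have "\<dots> \<le> (\<Sum>n\<le>m. fps_nth (log_layer n) m)"
    by (rule member_le_sum) (auto simp: log_layer_nonneg n)
  finally show ?thesis
    by (simp add: log_full_def log_partial_nth)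
qed

text \<open>Minus the logarithm of the modulus of \<open>E exp(iuX_t)\<close>, as
  \<open>decay_sums\<close> confirms by taking real parts; the linear term of the exponent is purely
  imaginary.\<close>

definition decay :: "real \<Rightarrow> real \<Rightarrow> real" where
  "decay t u = (\<Sum>m. fps_nth log_full m * t ^ m * (1 - cos (u * real m)))"

lemma decay_sums:
  fixes t u \<theta> :: real
  assumes "0 < t" "t < 1"
  shows "(\<lambda>m. fps_nth log_full m * t ^ m * (1 - cos (u * real m))) sums decay t u"
    and "norm (char_Z H2star t \<theta>) = exp (- decay t (\<theta> / sigma H2star t))"
proof -
  let ?c = "\<lambda>u. eval_fps (fps_embed log_full) (of_real t * iexp u) - of_real (eval_fps log_full t)
    - \<i> * of_real (u * cumulant 1 t)"
  have s: "(\<lambda>m. fps_nth log_full m * t ^ m * (1 - cos (u * real m))) sums (- Re (?c u))" for u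
  proof -
    have "(\<lambda>m. Re (of_real (fps_nth log_full m * t ^ m) * (iexp (u * real m) - 1 - \<i> * of_real (u * real m)))) sums Re (?c u)"
      by (rule sums_Re[OF sums_log_char[OF assms]])
    then have "(\<lambda>m. - (fps_nth log_full m * t ^ m * (1 - cos (u * real m)))) sums Re (?c u)"
      by (simp add: Re_exp algebra_simps)
    then show ?thesis
      using sums_minus by fastforce
  qed
  then show "(\<lambda>m. fps_nth log_full m * t ^ m * (1 - cos (u * real m))) sums decay t u"
    unfolding decay_def by (simp only: sums_iff)
  have "decay t u = - Re (?c u)" for u
    using s[of u] unfolding decay_def by (simp only: sums_iff)
  then show "norm (char_Z H2star t \<theta>) = exp (- decay t (\<theta> / sigma H2star t))"
    by (simp add: char_Z_H2star[OF assms])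
qed

text \<open>With \<open>z = t e^(iu)\<close> the sum is \<open>t/(1-t^2)\<close> minus the real part
  of the geometric series \<open>z/(1-z^2)\<close>. The quantity \<open>S\<close> is
  \<open>sinh (log (1/t))\<close>; it gives \<open>1 - t^2 = 2tS\<close> and squared modulus
  \<open>4 t^2 (S^2 + sin^2 u)\<close> for \<open>1 - z^2\<close>.\<close>

lemma odd_cosine_sums:
  fixes t u :: real
  assumes "0 < t" "t < 1"
  defines "S \<equiv> (1 - t ^ 2) / (2 * t)"
  shows "(\<lambda>m. if odd m then t ^ m * (1 - cos (u * real m)) else 0) sums
    ((S ^ 2 + sin u ^ 2 - S ^ 2 * cos u) / (2 * S * (S ^ 2 + sin u ^ 2)))"
proof -
  define z where "z = of_real t * iexp u"
  define D where "D = 1 - t ^ 2"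
  have D: "D > 0"
    using assms power_strict_mono[of t 1 2] by (simp add: D_def)
  have z: "norm (z ^ 2) < 1"
    using assms power_strict_mono[of t 1 2] by (simp add: z_def norm_mult norm_power)
  have "(\<lambda>i. z * (z ^ 2) ^ i) sums (z * (1 / (1 - z ^ 2)))"
    by (intro sums_mult geometric_sums z)
  then have "(\<lambda>i. Re (z * (z ^ 2) ^ i)) sums Re (z * (1 / (1 - z ^ 2)))"
    by (rule sums_Re)
  also have "(\<lambda>i. Re (z * (z ^ 2) ^ i)) = (\<lambda>i. t ^ (2 * i + 1) * cos (u * real (2 * i + 1)))"
  proof
    fix i
    have "z * (z ^ 2) ^ i = z ^ (2 * i + 1)"
      by (simp add: power_mult)
    also have "\<dots> = of_real (t ^ (2 * i + 1)) * iexp (u * real (2 * i + 1))"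
      unfolding z_def power_mult_distrib exp_of_nat_mult[symmetric] by (simp add: mult_ac)
    finally show "Re (z * (z ^ 2) ^ i) = t ^ (2 * i + 1) * cos (u * real (2 * i + 1))"
      by (simp add: Re_exp)
  qed
  finally have c: "(\<lambda>i. t ^ (2 * i + 1) * cos (u * real (2 * i + 1))) sums Re (z * (1 / (1 - z ^ 2)))" .
  have "(\<lambda>i. t * (t ^ 2) ^ i) sums (t * (1 / (1 - t ^ 2)))"
    by (intro sums_mult geometric_sums) (use D assms in \<open>auto simp: D_def\<close>)
  then have "(\<lambda>i. t * (t ^ 2) ^ i - t ^ (2 * i + 1) * cos (u * real (2 * i + 1))) sums (t * (1 / D) - Re (z * (1 / (1 - z ^ 2))))"
    unfolding D_def by (intro sums_diff c)
  moreover have "t * (t ^ 2) ^ i - t ^ (2 * i + 1) * cos (u * real (2 * i + 1)) =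
      (if odd (2 * i + 1) then t ^ (2 * i + 1) * (1 - cos (u * real (2 * i + 1))) else 0)" for i
    by (simp add: algebra_simps flip: power_mult)
  ultimately have "(\<lambda>i. if odd (2 * i + 1) then t ^ (2 * i + 1) * (1 - cos (u * real (2 * i + 1))) else 0) sums
      (t * (1 / D) - Re (z * (1 / (1 - z ^ 2))))"
    by (simp only:)
  then have "(\<lambda>m. if odd m then t ^ m * (1 - cos (u * real m)) else 0) sums
      (t * (1 / D) - Re (z * (1 / (1 - z ^ 2))))"
    by (subst (asm) sums_mono_reindex[of "\<lambda>i. 2 * i + 1" "\<lambda>m. if odd m then t ^ m * (1 - cos (u * real m)) else 0"])
      (auto simp: strict_mono_def elim!: oddE)
  moreover have "t * (1 / D) - Re (z * (1 / (1 - z ^ 2))) =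
      (S ^ 2 + sin u ^ 2 - S ^ 2 * cos u) / (2 * S * (S ^ 2 + sin u ^ 2))"
  proof -
    define c s where "c = cos u" and "s = sin u"
    have cs: "c ^ 2 = 1 - s ^ 2"
      by (simp add: c_def s_def cos_squared_eq)
    have zc: "z = Complex (t * c) (t * s)"
      by (simp add: z_def complex_eq_iff Re_exp Im_exp c_def s_def)
    have z2: "1 - z ^ 2 = Complex (1 - t ^ 2 * (c ^ 2 - s ^ 2)) (- (2 * t ^ 2 * c * s))"
      unfolding zc by (simp add: power2_eq_square complex_eq_iff algebra_simps)
    \<comment> \<open>\<open>den\<close> is the squared modulus of \<open>1 - z^2\<close>, and
      \<open>num\<close> the real part of \<open>z\<close> times the conjugate of
      \<open>1 - z^2\<close>.\<close>
    have den: "(1 - t ^ 2 * (c ^ 2 - s ^ 2)) ^ 2 + (- (2 * t ^ 2 * c * s)) ^ 2 = D ^ 2 + (2 * t * s) ^ 2"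
      unfolding D_def power_mult_distrib cs power2_minus by algebra
    have num: "t * c * (1 - t ^ 2 * (c ^ 2 - s ^ 2)) + t * s * (- (2 * t ^ 2 * c * s)) = t * c * D"
      unfolding D_def using cs by algebra
    have re: "Re (z * (1 / (1 - z ^ 2))) = t * c * D / (D ^ 2 + (2 * t * s) ^ 2)"
      unfolding times_divide_eq_right mult_1_right z2 unfolding zc Re_divide complex.sel num den ..
    have S: "D = 2 * t * S"
      using assms by (simp add: S_def D_def)
    have S0: "S > 0"
      using D assms unfolding S by (simp add: zero_less_mult_iff)
    have pos': "S ^ 2 + s ^ 2 > 0"
      using S0 by (intro add_pos_nonneg) auto
    have "t * (1 / D) - t * c * D / (D ^ 2 + (2 * t * s) ^ 2) = 1 / (2 * S) - c * S / (2 * (S ^ 2 + s ^ 2))"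
    proof -
      have "D ^ 2 + (2 * t * s) ^ 2 = 4 * t ^ 2 * (S ^ 2 + s ^ 2)"
        unfolding S by algebra
      moreover have "t * c * (2 * t * S) / (4 * t ^ 2 * (S ^ 2 + s ^ 2)) = c * S / (2 * (S ^ 2 + s ^ 2))"
        using assms pos' by (simp add: divide_simps power2_eq_square)
      ultimately show ?thesis
        using assms(1) S0 unfolding S by (simp add: mult_ac)
    qed
    also have "\<dots> = (S ^ 2 + s ^ 2 - S ^ 2 * c) / (2 * S * (S ^ 2 + s ^ 2))"
      using S0 pos' by (simp add: divide_simps power2_eq_square) (simp add: algebra_simps)
    finally show ?thesis
      unfolding re c_def s_def .
  qed
  ultimately show ?thesis
    by simp
qed

text \<open>Termwise comparison with 32 times \<open>odd_cosine_sums\<close>: odd coefficients are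
  at least 32, and the remaining terms are nonnegative.\<close>

lemma decay_ge:
  fixes t u :: real
  assumes "0 < t" "t < 1"
  defines "S \<equiv> (1 - t ^ 2) / (2 * t)"
  shows "decay t u \<ge> 16 * (S ^ 2 + sin u ^ 2 - S ^ 2 * cos u) / (S * (S ^ 2 + sin u ^ 2))"
proof -
  have "32 * ((S ^ 2 + sin u ^ 2 - S ^ 2 * cos u) / (2 * S * (S ^ 2 + sin u ^ 2))) \<le> decay t u"
  proof (rule sums_le)
    show "(\<lambda>m. 32 * (if odd m then t ^ m * (1 - cos (u * real m)) else 0)) sums
        (32 * ((S ^ 2 + sin u ^ 2 - S ^ 2 * cos u) / (2 * S * (S ^ 2 + sin u ^ 2))))"
      unfolding S_def by (intro sums_mult odd_cosine_sums assms)
    show "(\<lambda>m. fps_nth log_full m * t ^ m * (1 - cos (u * real m))) sums decay t u"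
      by (rule decay_sums[OF assms(1,2)])
    show "32 * (if odd m then t ^ m * (1 - cos (u * real m)) else 0) \<le>
        fps_nth log_full m * t ^ m * (1 - cos (u * real m))" for m
    proof (cases "odd m")
      case True
      have "32 * (t ^ m * (1 - cos (u * real m))) \<le> fps_nth log_full m * (t ^ m * (1 - cos (u * real m)))"
        by (rule mult_right_mono[OF log_full_nth_ge[OF True]]) (use assms in simp)
      then show ?thesis
        using True by (simp only: if_True mult.assoc not_False_eq_True)
    qed (use assms in \<open>simp add: log_full_nonneg\<close>)
  qed
  moreover have "32 * (a / (2 * b * c)) = 16 * a / (b * c)" for a b c :: real
    by simp
  ultimately show ?thesis
    by (simp only:)
qed

lemma decay_le:
  fixes t u :: real
  assumes "0 < t" "t < 1"
  shows "decay t u \<le> u ^ 2 / 2 * cumulant 2 t"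
proof (rule sums_le)
  show "(\<lambda>m. fps_nth log_full m * t ^ m * (1 - cos (u * real m))) sums decay t u"
    by (rule decay_sums[OF assms])
  show "(\<lambda>m. u ^ 2 / 2 * (real m ^ 2 * fps_nth log_full m * t ^ m)) sums (u ^ 2 / 2 * cumulant 2 t)"
    unfolding cumulant_def by (intro sums_mult summable_sums cumulant_bound(1) assms)
  show "fps_nth log_full m * t ^ m * (1 - cos (u * real m)) \<le> u ^ 2 / 2 * (real m ^ 2 * fps_nth log_full m * t ^ m)" for m
  proof -
    have "1 - cos x \<le> x ^ 2 / 2" for x :: real
    proof -
      have "cos x = 1 - 2 * sin (x / 2) ^ 2"
        using cos_double_sin[of "x / 2"] by simp
      moreover have "sin (x / 2) ^ 2 \<le> (x / 2) ^ 2"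
        using abs_sin_x_le_abs_x[of "x / 2"] abs_le_square_iff by blast
      ultimately show ?thesis
        by (simp add: power_divide)
    qed
    from this[of "u * real m"] have "fps_nth log_full m * t ^ m * (1 - cos (u * real m)) \<le>
        fps_nth log_full m * t ^ m * ((u * real m) ^ 2 / 2)"
      using assms by (intro mult_left_mono) (auto simp: log_full_nonneg)
    then show ?thesis
      by (simp add: power_mult_distrib mult_ac)
  qed
qed

text \<open>There are three regimes, with \<open>v = sin^2 u\<close>. For
  \<open>\<bar>u\<bar> > pi/2\<close> the exponent is at least \<open>16/S\<close>. Otherwise
  \<open>S^2 (1 - cos u)\<close> is dropped, leaving \<open>16 v / (S (S^2 + v))\<close>: at least
  \<open>8 v / S^3\<close> if \<open>v \<le> S^2\<close>, the Gaussian zone, and at least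
  \<open>8/S\<close> if not. The sum on the right covers all cases.\<close>

lemma exp_decay_le:
  fixes t u :: real
  assumes "0 < t" "t < 1" "\<bar>u\<bar> \<le> pi"
  defines "S \<equiv> (1 - t ^ 2) / (2 * t)"
  shows "exp (- decay t u) \<le> exp (- 8 / S) + exp (- (u ^ 2 / (2 * S ^ 3)))"
proof -
  have S: "S > 0"
    using assms power_strict_mono[of t 1 2] by (simp add: S_def)
  define v where "v = sin u ^ 2"
  have v: "v \<ge> 0" by (simp add: v_def)
  have ge: "decay t u \<ge> 16 * (S ^ 2 + v - S ^ 2 * cos u) / (S * (S ^ 2 + v))"
    unfolding v_def S_def by (rule decay_ge[OF assms(1,2)])
  have Sv: "S ^ 2 + v > 0"
    using S v by (intro add_pos_nonneg) auto
  with S have pos: "S * (S ^ 2 + v) > 0"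
    by (rule mult_pos_pos)
  show ?thesis
  proof (cases "\<bar>u\<bar> \<le> pi / 2")
    case False
    \<comment> \<open>Near \<open>u = pi\<close> the sine is no help; the decay comes from the sign
      of the cosine, reflecting that odd \<open>m\<close> contribute
      \<open>cos (pi m) = -1\<close>.\<close>
    have "cos u \<le> 0"
    proof -
      have "cos \<bar>u\<bar> \<le> cos (pi / 2)"
        by (rule cos_monotone_0_pi_le) (use False assms in auto)
      then show ?thesis by simp
    qed
    then have "S ^ 2 + v \<le> S ^ 2 + v - S ^ 2 * cos u"
      using mult_nonneg_nonpos[of "S ^ 2" "cos u"] by simp
    then have "16 * (S ^ 2 + v) / (S * (S ^ 2 + v)) \<le> decay t u"
      using pos by (intro order.trans[OF _ ge] divide_right_mono mult_left_mono) linarith+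
    moreover have "16 * (S ^ 2 + v) / (S * (S ^ 2 + v)) = 16 / S"
      by (rule nonzero_mult_divide_mult_cancel_right) (use pos in auto)
    moreover have "8 / S \<le> 16 / S"
      using S by (simp add: divide_right_mono)
    ultimately have "exp (- decay t u) \<le> exp (- 8 / S)"
      by simp
    then show ?thesis
      by (simp add: add_increasing2)
  next
    case True
    have "(u / 3) ^ 2 \<le> v"
      unfolding v_def using abs_sin_ge_third[OF True] by (simp add: abs_le_square_iff[symmetric])
    then have uv: "u ^ 2 \<le> 9 * v"
      by (simp add: power_divide)
    have "16 * v / (S * (S ^ 2 + v)) \<le> decay t u"
    proof (rule order.trans[OF _ ge], rule divide_right_mono)
      have "S ^ 2 * cos u \<le> S ^ 2 * 1"
        by (intro mult_left_mono) auto
      then show "16 * v \<le> 16 * (S ^ 2 + v - S ^ 2 * cos u)"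
        by simp
    qed (use pos in simp)
    note ge' = this
    show ?thesis
    proof (cases "v \<le> S ^ 2")
      case True
      have "8 * v / S ^ 3 = 16 * v / (S * (S ^ 2 + S ^ 2))"
        by (simp add: power3_eq_cube power2_eq_square)
      also have "\<dots> \<le> 16 * v / (S * (S ^ 2 + v))"
        using True S v Sv by (intro divide_left_mono mult_left_mono mult_pos_pos) auto
      finally have "8 * v / S ^ 3 \<le> decay t u"
        using ge' by simp
      \<comment> \<open>The factor 9 in \<open>uv\<close> is relaxed to 16, so that the right-hand
        side equals \<open>8 v / S^3\<close>.\<close>
      moreover have "u ^ 2 / (2 * S ^ 3) \<le> 16 * v / (2 * S ^ 3)"
        using uv v S by (intro divide_right_mono) auto
      ultimately have "exp (- decay t u) \<le> exp (- (u ^ 2 / (2 * S ^ 3)))"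
        by simp
      then show ?thesis
        by (simp add: add_increasing)
    next
      case False
      have "v > 0"
        using False zero_le_power2[of S] by linarith
      then have "8 / S = 16 * v / (S * (v + v))"
        using S by (simp add: field_simps)
      also have "\<dots> \<le> 16 * v / (S * (S ^ 2 + v))"
        using False S \<open>v > 0\<close> Sv by (intro divide_left_mono mult_left_mono mult_pos_pos) auto
      finally have "exp (- decay t u) \<le> exp (- 8 / S)"
        using ge' by simp
      then show ?thesis
        by (simp add: add_increasing2)
    qed
  qed
qed

lemma half_width_le:
  fixes t :: real
  assumes "1 / 2 \<le> t" "t < 1"
  shows "(1 - t ^ 2) / (2 * t) \<le> 2 * (1 - t)" "0 < (1 - t ^ 2) / (2 * t)"
proof -
  have e: "1 - t ^ 2 = (1 - t) * (1 + t)"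
    by (simp add: power2_eq_square algebra_simps)
  have "(1 - t) * (1 + t) \<le> (1 - t) * (4 * t)"
    using assms by (intro mult_left_mono) auto
  then show "(1 - t ^ 2) / (2 * t) \<le> 2 * (1 - t)"
    using assms by (simp add: e field_simps)
  show "0 < (1 - t ^ 2) / (2 * t)"
    using assms by (auto simp: e intro!: divide_pos_pos mult_pos_pos)
qed

text \<open>The two bounds for the decay are compared at \<open>u = S\<close>, where \<open>S = (1 - t\<^sup>2) / (2t)\<close> is the width of
  the central peak of the characteristic function.\<close>

lemma cumulant_2_ge:
  fixes t :: real
  assumes "1 / 2 \<le> t" "t < 1"
  shows "cumulant 2 t \<ge> 1 / (3 * (1 - t) ^ 3)"
proof -
  define S where "S = (1 - t ^ 2) / (2 * t)"
  have S: "0 < S" "S \<le> 2 * (1 - t)"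
    using half_width_le[OF assms] by (simp_all add: S_def)
  then have "S \<le> 1"
    using assms by simp
  have "\<bar>S\<bar> / 3 \<le> \<bar>sin S\<bar>"
    by (rule abs_sin_ge_third) (use \<open>S \<le> 1\<close> S pi_gt3 in auto)
  then have "(S / 3) ^ 2 \<le> sin S ^ 2"
    by (simp add: abs_le_square_iff[symmetric])
  then have v: "S ^ 2 \<le> 9 * sin S ^ 2"
    by (simp add: power_divide)
  define v where "v = sin S ^ 2"
  have "0 < S ^ 2"
    using S by simp
  with v have v_pos: "v > 0"
    unfolding v_def by linarith
  have pos: "S * (S ^ 2 + v) > 0"
    using S v_pos by (intro mult_pos_pos add_pos_nonneg) auto
  \<comment> \<open>By \<open>S^2 \<le> 9 v\<close> the denominator \<open>S^2 + v\<close> is at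
    most \<open>10 v\<close>.\<close>
  have "16 / (10 * S) = 16 * v / (S * (9 * v + v))"
    using S v_pos by (simp add: field_simps)
  also have "\<dots> \<le> 16 * v / (S * (S ^ 2 + v))"
    using S pos v v_pos unfolding v_def[symmetric]
    by (intro divide_left_mono mult_left_mono mult_pos_pos add_right_mono add_pos_pos) auto
  also have "\<dots> \<le> 16 * (S ^ 2 + v - S ^ 2 * cos S) / (S * (S ^ 2 + v))"
  proof (rule divide_right_mono)
    have "S ^ 2 * cos S \<le> S ^ 2 * 1"
      by (intro mult_left_mono) auto
    then show "16 * v \<le> 16 * (S ^ 2 + v - S ^ 2 * cos S)"
      by simp
  qed (use pos in simp)
  also have "\<dots> \<le> decay t S"
    using decay_ge[of t S] assms by (simp add: v_def S_def)
  also have "\<dots> \<le> S ^ 2 / 2 * cumulant 2 t"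
    by (rule decay_le) (use assms in auto)
  finally have "32 / (10 * S ^ 3) \<le> cumulant 2 t"
    using S by (simp add: field_simps power3_eq_cube power2_eq_square)
  \<comment> \<open>The cube of \<open>S \<le> 2 (1 - t)\<close> gives
    \<open>10 S^3 \<le> 80 (1 - t)^3\<close>, within the \<open>96 = 3 * 32\<close> needed.\<close>
  moreover have "1 / (3 * (1 - t) ^ 3) \<le> 32 / (10 * S ^ 3)"
  proof -
    have "S ^ 3 \<le> (2 * (1 - t)) ^ 3"
      using S by (intro power_mono) auto
    also have "\<dots> = 8 * (1 - t) ^ 3"
      by (subst power_mult_distrib) simp
    finally have "10 * S ^ 3 \<le> 96 * (1 - t) ^ 3"
      using assms zero_le_power[of "1 - t" 3] by linarith
    then show ?thesis
      using S assms by (simp add: field_simps)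
  qed
  ultimately show ?thesis by simp
qed

section \<open>Convergence to the Gaussian\<close>

text \<open>The single term \<open>m = 1\<close> suffices, and it works on all of (0,1), whereas
  \<open>sigma_bounds\<close> starts at \<open>t = 1/2\<close>.\<close>

lemma sigma_pos:
  assumes "0 < t" "t < 1"
  shows "sigma H2star t > 0"
proof -
  have "(\<Sum>m\<in>{1}. real m ^ 2 * fps_nth log_full m * t ^ m) \<le> cumulant 2 t"
    unfolding cumulant_def
    by (rule sum_le_suminf[OF cumulant_bound(1)]) (use assms in \<open>auto simp: log_full_nonneg\<close>)
  moreover have "0 < fps_nth log_full 1 * t"
    using log_full_nth_ge[of 1] assms by simp
  ultimately show ?thesis
    by (simp add: sigma_H2star assms)
qed

lemma sigma_power2:
  assumes "0 < t" "t < 1"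
  shows "sigma H2star t ^ 2 = cumulant 2 t"
  using sigma_pos[OF assms] by (simp add: sigma_H2star[OF assms])

lemma sigma_bounds:
  assumes "1 / 2 \<le> t" "t < 1"
  shows "sigma H2star t ^ 2 \<le> 1024 / (1 - t) ^ 3" "1 / (3 * (1 - t) ^ 3) \<le> sigma H2star t ^ 2"
  using cumulant_bound(2)[of t 2] cumulant_2_ge[of t] assms
  by (simp_all add: sigma_power2)

text \<open>The range of \<open>\<theta>\<close> is exactly \<open>\<bar>u\<bar> \<le> pi\<close>.
  In \<open>exp_decay_le\<close>, the cubic term of the exponential series gives
  \<open>exp (-8/S) \<le> 6 S^3 / 512\<close>, and \<open>S^3 \<le> 8 (1-t)^3\<close> turns this
  into \<open>(1-t)^3\<close>. For the Gaussian term,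
  \<open>\<sigma>^2 S^3 \<le> 1024 * 8 = 8192\<close>.\<close>

lemma char_Z_le:
  fixes t \<theta> :: real
  assumes "1 / 2 \<le> t" "t < 1" "\<bar>\<theta>\<bar> \<le> pi * sigma H2star t"
  shows "norm (char_Z H2star t \<theta>) \<le> (1 - t) ^ 3 + exp (- (\<theta> ^ 2 / 16384))"
proof -
  define S where "S = (1 - t ^ 2) / (2 * t)"
  define \<sigma> where "\<sigma> = sigma H2star t"
  define u where "u = \<theta> / \<sigma>"
  have t: "0 < t" "t < 1" using assms by simp_all
  have S: "0 < S" "S \<le> 2 * (1 - t)"
    using half_width_le[OF assms(1,2)] by (simp_all add: S_def)
  have \<sigma>: "\<sigma> > 0"
    using sigma_pos[OF t] by (simp add: \<sigma>_def)
  have S3: "S ^ 3 \<le> 8 * (1 - t) ^ 3"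
  proof -
    have "S ^ 3 \<le> (2 * (1 - t)) ^ 3"
      using S by (intro power_mono) auto
    also have "\<dots> = 8 * (1 - t) ^ 3"
      by (subst power_mult_distrib) simp
    finally show ?thesis .
  qed
  have "norm (char_Z H2star t \<theta>) = exp (- decay t u)"
    unfolding u_def \<sigma>_def by (rule decay_sums(2)[OF t])
  also have "\<bar>u\<bar> \<le> pi"
    using assms(3) \<sigma> by (simp add: u_def \<sigma>_def field_simps)
  then have "exp (- decay t u) \<le> exp (- 8 / S) + exp (- (u ^ 2 / (2 * S ^ 3)))"
    unfolding S_def by (rule exp_decay_le[OF t])
  also have "exp (- 8 / S) \<le> (1 - t) ^ 3"
  proof -
    have "(8 / S) ^ 3 \<le> fact 3 * exp (8 / S)"
      by (rule power_le_fact_mult_exp) (use S in simp)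
    then have "512 \<le> S ^ 3 * (6 * exp (8 / S))"
      using S by (simp add: field_simps fact_numeral)
    also have "\<dots> \<le> (8 * (1 - t) ^ 3) * (6 * exp (8 / S))"
      by (intro mult_right_mono S3) auto
    finally have "1 \<le> (1 - t) ^ 3 * exp (8 / S)"
      by simp
    then show ?thesis
      by (simp add: exp_minus field_simps)
  qed
  also have "exp (- (u ^ 2 / (2 * S ^ 3))) \<le> exp (- (\<theta> ^ 2 / 16384))"
  proof -
    have "\<sigma> ^ 2 * S ^ 3 \<le> (1024 / (1 - t) ^ 3) * (8 * (1 - t) ^ 3)"
      unfolding \<sigma>_def by (intro mult_mono sigma_bounds S3) (use assms S in auto)
    also have "\<dots> = 8192"
      using assms by simp
    finally have "\<theta> ^ 2 / 16384 \<le> \<theta> ^ 2 / (2 * (\<sigma> ^ 2 * S ^ 3))"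
      using S \<sigma> by (intro divide_left_mono) (auto simp: mult.commute)
    also have "\<dots> = u ^ 2 / (2 * S ^ 3)"
      by (simp add: u_def power_divide)
    finally show ?thesis by simp
  qed
  finally show ?thesis by simp
qed

section \<open>Pointwise convergence\<close>

text \<open>The exponent of \<open>char_Z_H2star\<close> gets its own name as a logarithm of the
  characteristic function; no branch has to be chosen.\<close>

definition log_char :: "real \<Rightarrow> real \<Rightarrow> complex" where
  "log_char t \<theta> = (let u = \<theta> / sigma H2star t in
     eval_fps (fps_embed log_full) (of_real t * iexp u)
      - of_real (eval_fps log_full t) - \<i> * of_real (u * cumulant 1 t))"

lemma char_Z_eq_exp_log_char:
  assumes "0 < t" "t < 1"
  shows "char_Z H2star t \<theta> = exp (log_char t \<theta>)"
  by (simp add: char_Z_H2star[OF assms] log_char_def Let_def)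

lemma continuous_char_Z:
  assumes "0 < t" "t < 1"
  shows "continuous_on A (char_Z H2star t)"
proof -
  have "continuous_on A (\<lambda>\<theta>. exp (log_char t \<theta>))"
    unfolding log_char_def Let_def
    using assms sigma_pos[OF assms] less_conv_radius[of t, OF _ fps_conv_radius_log_full]
    by (intro continuous_intros) (auto simp: norm_mult)
  then show ?thesis
    by (simp add: char_Z_eq_exp_log_char assms cong: continuous_on_cong)
qed

text \<open>Each \<open>iexp\<close> is expanded to second order. The quadratic terms sum to
  \<open>\<theta>^2 / 2\<close>, since \<open>\<sigma>^2\<close> is the second cumulant, and the
  remainders to at most \<open>\<bar>u\<bar>^3 / 6\<close> times the third cumulant. The square root
  bounds the third cumulant divided by \<open>\<sigma>^3\<close>.\<close>

lemma log_char_approx: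
  fixes t \<theta> :: real
  assumes "1 / 2 \<le> t" "t < 1"
  shows "norm (log_char t \<theta> - of_real (- (\<theta> ^ 2 / 2))) \<le> \<bar>\<theta>\<bar> ^ 3 / 6 * sqrt (27 * 6144 ^ 2 * (1 - t))"
proof -
  define \<sigma> where "\<sigma> = sigma H2star t"
  define u where "u = \<theta> / \<sigma>"
  define d where "d = 1 - t"
  have t: "0 < t" "t < 1" and d: "d > 0" using assms by (simp_all add: d_def)
  have \<sigma>: "\<sigma> > 0"
    using sigma_pos[OF t] by (simp add: \<sigma>_def)
  let ?a = "\<lambda>m. fps_nth log_full m * t ^ m"
  have "(\<lambda>m. of_real (?a m) * (iexp (u * real m) - 1 - \<i> * of_real (u * real m))) sums log_char t \<theta>"
    using sums_log_char[OF t, of u] by (simp add: log_char_def u_def \<sigma>_def Let_def)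
  moreover have "(\<lambda>m. u ^ 2 / 2 * (real m ^ 2 * fps_nth log_full m * t ^ m)) sums (u ^ 2 / 2 * cumulant 2 t)"
    unfolding cumulant_def by (intro sums_mult summable_sums cumulant_bound(1) t)
  then have "(\<lambda>m. of_real (u ^ 2 / 2 * (real m ^ 2 * fps_nth log_full m * t ^ m))) sums
      complex_of_real (u ^ 2 / 2 * cumulant 2 t)"
    by (simp only: sums_of_real_iff)
  moreover have "u ^ 2 / 2 * cumulant 2 t = \<theta> ^ 2 / 2"
    using \<sigma> by (simp add: u_def power_divide flip: sigma_power2[OF t] \<sigma>_def)
  ultimately have "(\<lambda>m. of_real (?a m) * (iexp (u * real m) - 1 - \<i> * of_real (u * real m)) +
      of_real (u ^ 2 / 2 * (real m ^ 2 * fps_nth log_full m * t ^ m))) sums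
      (log_char t \<theta> + of_real (\<theta> ^ 2 / 2))"
    by (simp only: sums_add)
  \<comment> \<open>The added term is minus the \<open>k = 2\<close> Taylor term, because
    \<open>\<i>^2 = -1\<close>.\<close>
  also have "(\<lambda>m. of_real (?a m) * (iexp (u * real m) - 1 - \<i> * of_real (u * real m)) +
      of_real (u ^ 2 / 2 * (real m ^ 2 * fps_nth log_full m * t ^ m))) =
      (\<lambda>m. of_real (?a m) * (iexp (u * real m) - (\<Sum>k\<le>2. (\<i> * of_real (u * real m)) ^ k / fact k)))"
    by (simp add: fun_eq_iff eval_nat_numeral algebra_simps)
  finally have s: "(\<lambda>m. of_real (?a m) * (iexp (u * real m) - (\<Sum>k\<le>2. (\<i> * of_real (u * real m)) ^ k / fact k))) sums
      (log_char t \<theta> + of_real (\<theta> ^ 2 / 2))" .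
  have s3: "(\<lambda>m. \<bar>u\<bar> ^ 3 / 6 * (real m ^ 3 * fps_nth log_full m * t ^ m)) sums (\<bar>u\<bar> ^ 3 / 6 * cumulant 3 t)"
    unfolding cumulant_def by (intro sums_mult summable_sums cumulant_bound(1) t)
  have le: "norm (of_real (?a m) * (iexp (u * real m) - (\<Sum>k\<le>2. (\<i> * of_real (u * real m)) ^ k / fact k)))
      \<le> \<bar>u\<bar> ^ 3 / 6 * (real m ^ 3 * fps_nth log_full m * t ^ m)" for m
  proof -
    have "norm (iexp (u * real m) - (\<Sum>k\<le>2. (\<i> * of_real (u * real m)) ^ k / fact k)) \<le> \<bar>u * real m\<bar> ^ Suc 2 / fact (Suc 2)"
      by (rule iexp_approx1)
    also have "\<dots> = \<bar>u\<bar> ^ 3 * real m ^ 3 / 6"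
      by (simp add: fact_numeral abs_mult power_mult_distrib eval_nat_numeral)
    finally have "?a m * norm (iexp (u * real m) - (\<Sum>k\<le>2. (\<i> * of_real (u * real m)) ^ k / fact k)) \<le>
        ?a m * (\<bar>u\<bar> ^ 3 * real m ^ 3 / 6)"
      using t by (intro mult_left_mono) (auto simp: log_full_nonneg)
    then show ?thesis
      using t unfolding norm_mult norm_of_real by (simp add: log_full_nonneg abs_mult mult_ac)
  qed
  have "norm (log_char t \<theta> + of_real (\<theta> ^ 2 / 2)) \<le> \<bar>u\<bar> ^ 3 / 6 * cumulant 3 t"
    using norm_suminf_le[OF le sums_summable[OF s3]] s s3 by (simp only: sums_iff)
  also have "\<dots> = \<bar>\<theta>\<bar> ^ 3 / 6 * (cumulant 3 t / \<sigma> ^ 3)"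
    using \<sigma> by (simp add: u_def power_divide)
  also have "\<dots> \<le> \<bar>\<theta>\<bar> ^ 3 / 6 * sqrt (27 * 6144 ^ 2 * d)"
  proof (rule mult_left_mono)
    have c3: "0 \<le> cumulant 3 t"
      unfolding cumulant_def by (intro suminf_nonneg cumulant_bound(1) t) (use t in \<open>auto simp: log_full_nonneg\<close>)
    \<comment> \<open>Here \<open>2^10 * 3! = 6144\<close>. Only \<open>\<sigma>^2\<close> is
      bounded directly, so the ratio is squared: \<open>d^(-8)\<close> against \<open>d^(-9)\<close>
      leaves one factor \<open>d\<close>, and 27 is the cube of the 3 in
      \<open>sigma_bounds\<close>.\<close>
    have "cumulant 3 t \<le> 6144 / d ^ 4"
      using cumulant_bound(2)[OF t, of 3] by (simp add: d_def fact_numeral)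
    then have "cumulant 3 t ^ 2 \<le> (6144 / d ^ 4) ^ 2"
      using c3 by (rule power_mono)
    moreover have "(1 / (3 * d ^ 3)) ^ 3 \<le> (\<sigma> ^ 2) ^ 3"
      using sigma_bounds(2)[OF assms] d by (intro power_mono) (auto simp: d_def \<sigma>_def)
    ultimately have "cumulant 3 t ^ 2 / (\<sigma> ^ 2) ^ 3 \<le> (6144 / d ^ 4) ^ 2 / (1 / (3 * d ^ 3)) ^ 3"
      using d \<sigma> by (intro frac_le) auto
    also have "\<dots> = 27 * 6144 ^ 2 * d"
      using d by (simp add: power_divide power_mult_distrib field_simps flip: power_mult power_add power_Suc power_Suc2)
    also have "cumulant 3 t ^ 2 / (\<sigma> ^ 2) ^ 3 = (cumulant 3 t / \<sigma> ^ 3) ^ 2"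
      by (simp add: power_divide flip: power_mult)
    finally show "cumulant 3 t / \<sigma> ^ 3 \<le> sqrt (27 * 6144 ^ 2 * d)"
      by (rule real_le_rsqrt)
  qed simp
  finally show ?thesis
    by (simp add: d_def)
qed

lemma char_Z_tendsto: "((\<lambda>t. char_Z H2star t \<theta>) \<longlongrightarrow> of_real (exp (- (\<theta> ^ 2 / 2)))) (at_left 1)"
proof -
  have ev: "\<forall>\<^sub>F t in at_left (1::real). 1 / 2 \<le> t \<and> t < 1"
    by (rule eventually_at_leftI[of "1 / 2"]) auto
  have "((\<lambda>t. \<bar>\<theta>\<bar> ^ 3 / 6 * sqrt (27 * 6144 ^ 2 * (1 - t))) \<longlongrightarrow> \<bar>\<theta>\<bar> ^ 3 / 6 * sqrt (27 * 6144 ^ 2 * (1 - 1))) (at_left 1)"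
    by (intro tendsto_intros)
  then have "((\<lambda>t. \<bar>\<theta>\<bar> ^ 3 / 6 * sqrt (27 * 6144 ^ 2 * (1 - t))) \<longlongrightarrow> 0) (at_left 1)"
    by simp
  then have "((\<lambda>t. log_char t \<theta> - of_real (- (\<theta> ^ 2 / 2))) \<longlongrightarrow> 0) (at_left 1)"
    by (rule Lim_null_comparison[rotated]) (use ev in eventually_elim, use log_char_approx in blast)
  then have "((\<lambda>t. exp (log_char t \<theta>)) \<longlongrightarrow> exp (of_real (- (\<theta> ^ 2 / 2)))) (at_left 1)"
    by (intro tendsto_exp) (simp only: LIM_zero_iff)
  then have "((\<lambda>t. exp (log_char t \<theta>)) \<longlongrightarrow> of_real (exp (- (\<theta> ^ 2 / 2)))) (at_left 1)"
    by (simp only: exp_of_real)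
  then show ?thesis
    by (rule Lim_transform_eventually)
      (use ev in eventually_elim, use char_Z_eq_exp_log_char in \<open>auto simp: less_le_trans[of 0 "1 / 2"]\<close>)
qed

section \<open>Dominated convergence\<close>

definition char_error :: "real \<Rightarrow> real \<Rightarrow> real" where
  "char_error t \<theta> = norm (char_Z H2star t \<theta> - of_real (exp (- (\<theta> ^ 2 / 2))))"

text \<open>The part of the bound on the error that does not depend on \<open>t\<close>: the
  Gaussian term of \<open>char_Z_le\<close> and the limit itself.\<close>

definition gauss_dominator :: "real \<Rightarrow> real" where
  "gauss_dominator \<theta> = exp (- (\<theta> ^ 2 / 16384)) + exp (- (\<theta> ^ 2 / 2))"

lemma integrable_gauss_dominator: "integrable lborel gauss_dominator"
proof -
  have "integrable lborel (\<lambda>x. exp (- (x ^ 2 / (2 * \<sigma> ^ 2))))" if "\<sigma> > 0" for \<sigma> :: real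
  proof -
    have "integrable lborel (\<lambda>x. sqrt (2 * pi * \<sigma> ^ 2) * normal_density 0 \<sigma> x)"
      using that by (intro integrable_mult_right integrable_normal_density) auto
    then show ?thesis
      using that by (simp add: normal_density_def)
  qed
  \<comment> \<open>The two summands are Gaussians of variance 8192 and 1, since
    \<open>16384 = 2 * 8192\<close>.\<close>
  from this[of "sqrt 8192"] this[of 1] show ?thesis
    unfolding gauss_dominator_def by (intro Bochner_Integration.integrable_add) simp_all
qed

lemma gauss_dominator_nonneg: "gauss_dominator \<theta> \<ge> 0"
  by (simp add: gauss_dominator_def)

lemma continuous_char_error:
  assumes "0 < t" "t < 1"
  shows "continuous_on A (char_error t)"
  unfolding char_error_def by (intro continuous_intros continuous_char_Z[OF assms]) auto

text \<open>The dominator controls the error only up to \<open>(1-t)^3\<close> and only on an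
  interval growing with \<open>\<sigma>\<close>. Taking the minimum with it gives an integrand on
  the whole line with a fixed integrable majorant. The excess costs at most \<open>(1-t)^3\<close>
  times the length \<open>2 pi \<sigma>\<close>, which vanishes in the limit.\<close>

lemma integral_char_error_le:
  assumes "1 / 2 \<le> t" "t < 1"
  defines "\<sigma> \<equiv> sigma H2star t"
  shows "integral {- pi * \<sigma>..pi * \<sigma>} (char_error t) \<le> (LINT \<theta>|lborel. min (char_error t \<theta>) (gauss_dominator \<theta>)) + 64 * pi * (1 - t)"
proof -
  have t: "0 < t" "t < 1" using assms by simp_all
  have \<sigma>: "\<sigma> > 0"
    using sigma_pos[OF t] by (simp add: \<sigma>_def)
  let ?I = "{- pi * \<sigma>..pi * \<sigma>}"
  let ?m = "\<lambda>\<theta>. min (char_error t \<theta>) (gauss_dominator \<theta>)"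
  have cd: "continuous_on UNIV gauss_dominator"
    unfolding gauss_dominator_def by (intro continuous_intros) auto
  have cm: "continuous_on UNIV ?m"
    by (intro continuous_intros continuous_char_error t cd)
  have mm: "?m \<in> borel_measurable borel"
    by (rule borel_measurable_continuous_onI[OF cm])
  have im: "integrable lborel ?m"
    by (rule Bochner_Integration.integrable_bound[OF integrable_gauss_dominator])
      (use mm in \<open>auto simp: gauss_dominator_nonneg char_error_def min_def\<close>)
  have sm: "set_integrable lborel ?I ?m"
    by (rule borel_integrable_atLeastAtMost') (rule continuous_on_subset[OF cm], simp)
  have "integral ?I (char_error t) \<le> integral ?I (\<lambda>\<theta>. ?m \<theta> + (1 - t) ^ 3)"
  proof (rule integral_le)
    show "char_error t integrable_on ?I"
      by (intro integrable_continuous_real continuous_char_error t)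
    show "(\<lambda>\<theta>. ?m \<theta> + (1 - t) ^ 3) integrable_on ?I"
      by (intro integrable_continuous_real continuous_intros continuous_on_subset[OF cm]) simp
    fix \<theta> assume "\<theta> \<in> ?I"
    then have "norm (char_Z H2star t \<theta>) \<le> (1 - t) ^ 3 + exp (- (\<theta> ^ 2 / 16384))"
      by (intro char_Z_le assms) (auto simp: \<sigma>_def)
    then have "char_error t \<theta> \<le> (1 - t) ^ 3 + gauss_dominator \<theta>"
      unfolding char_error_def gauss_dominator_def
      using norm_triangle_ineq4[of "char_Z H2star t \<theta>" "of_real (exp (- (\<theta> ^ 2 / 2)))"]
      by (simp only: norm_of_real abs_exp_cancel)
    moreover have "(1 - t) ^ 3 \<ge> 0"
      using t by simp
    ultimately show "char_error t \<theta> \<le> ?m \<theta> + (1 - t) ^ 3"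
      by linarith
  qed
  also have "\<dots> = integral ?I ?m + integral ?I (\<lambda>\<theta>. (1 - t) ^ 3)"
    by (intro integral_add integrable_continuous_real continuous_on_subset[OF cm]) auto
  also have "integral ?I (\<lambda>\<theta>. (1 - t) ^ 3) = 2 * pi * \<sigma> * (1 - t) ^ 3"
    using \<sigma> by simp
  also have "\<dots> \<le> 64 * pi * (1 - t)"
  proof -
    \<comment> \<open>The exponent 3 is weakened to 4 to make the bound a perfect square;
      \<open>\<sigma> (1-t)^3\<close> still keeps one factor \<open>1 - t\<close>.\<close>
    have "\<sigma> ^ 2 \<le> (32 / (1 - t) ^ 2) ^ 2"
    proof -
      have "(1 - t) ^ 4 \<le> (1 - t) ^ 3"
        using t by (intro power_decreasing) auto
      then have "1024 / (1 - t) ^ 3 \<le> 1024 / (1 - t) ^ 4"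
        using t by (intro divide_left_mono) auto
      then show ?thesis
        using sigma_bounds(1)[OF assms(1,2)] by (simp add: \<sigma>_def power_divide flip: power_mult)
    qed
    then have "\<sigma> \<le> 32 / (1 - t) ^ 2"
      by (rule power2_le_imp_le) (use t in simp)
    then have "\<sigma> * (1 - t) ^ 3 \<le> 32 / (1 - t) ^ 2 * (1 - t) ^ 3"
      using t by (intro mult_right_mono) auto
    also have "\<dots> = 32 * (1 - t)"
      using t by (simp add: power2_eq_square power3_eq_cube)
    finally show ?thesis
      by simp
  qed
  \<comment> \<open>The condition is stated with the gauge integral, dominated convergence with the
    Lebesgue integral; for a continuous integrand on a compact interval they agree.\<close>
  also have "integral ?I ?m = (LINT \<theta>:?I|lborel. ?m \<theta>)"
    by (rule set_borel_integral_eq_integral(2)[OF sm, symmetric])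
  also have "\<dots> \<le> (LINT \<theta>|lborel. ?m \<theta>)"
    unfolding set_lebesgue_integral_def
    by (rule integral_mono) (use im sm in \<open>auto simp: set_integrable_def indicator_def gauss_dominator_nonneg char_error_def min_def\<close>)
  finally show ?thesis
    by simp
qed

text \<open>Dominated convergence is applied along sequences that increase or wander to 1 inside
  (1/2, 1). The truncated error tends to \<open>min 0 (gauss_dominator \<theta>) = 0\<close>
  pointwise, and the bound of \<open>integral_char_error_le\<close> squeezes the integral.\<close>

lemma integral_char_error_tendsto:
  "((\<lambda>t. integral {- pi * sigma H2star t..pi * sigma H2star t} (char_error t)) \<longlongrightarrow> 0) (at_left 1)"
proof (rule tendsto_at_left_sequentially[of "1 / 2"])
  fix T :: "nat \<Rightarrow> real"
  assume T: "\<And>n. T n < 1" "\<And>n. 1 / 2 < T n" "T \<longlonglongrightarrow> 1"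
  have T': "0 < T n" "1 / 2 \<le> T n" for n
    using T(2)[of n] by simp_all
  have "(\<lambda>n. LINT \<theta>|lborel. min (char_error (T n) \<theta>) (gauss_dominator \<theta>)) \<longlonglongrightarrow> (LINT \<theta>|(lborel :: real measure). (0 :: real))"
  proof (rule integral_dominated_convergence[where w = gauss_dominator])
    show "(\<lambda>\<theta>. min (char_error (T n) \<theta>) (gauss_dominator \<theta>)) \<in> borel_measurable lborel" for n
    proof -
      have "continuous_on UNIV (\<lambda>\<theta>. min (char_error (T n) \<theta>) (gauss_dominator \<theta>))"
        unfolding gauss_dominator_def by (intro continuous_intros continuous_char_error T T') auto
      then show ?thesis
        using borel_measurable_continuous_onI by simp
    qed
    have lim: "filterlim T (at_left 1) sequentially"
      unfolding filterlim_at using T(1,3) by (auto intro!: always_eventually simp: less_imp_neq)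
    have "(\<lambda>n. min (char_error (T n) \<theta>) (gauss_dominator \<theta>)) \<longlonglongrightarrow> min 0 (gauss_dominator \<theta>)" for \<theta>
    proof (intro tendsto_min tendsto_const)
      have "(\<lambda>n. char_Z H2star (T n) \<theta>) \<longlonglongrightarrow> of_real (exp (- (\<theta> ^ 2 / 2)))"
        by (rule filterlim_compose[OF char_Z_tendsto lim])
      then show "(\<lambda>n. char_error (T n) \<theta>) \<longlonglongrightarrow> 0"
        unfolding char_error_def by (intro tendsto_norm_zero) (simp only: LIM_zero_iff)
    qed
    then show "AE \<theta> in lborel. (\<lambda>n. min (char_error (T n) \<theta>) (gauss_dominator \<theta>)) \<longlonglongrightarrow> 0"
      by (simp add: gauss_dominator_nonneg min_absorb1)
    show "AE \<theta> in lborel. norm (min (char_error (T n) \<theta>) (gauss_dominator \<theta>)) \<le> gauss_dominator \<theta>" for n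
      by (auto simp: gauss_dominator_nonneg char_error_def min_def)
  qed (auto intro: integrable_gauss_dominator)
  moreover have "(\<lambda>n. 64 * pi * (1 - T n)) \<longlonglongrightarrow> 64 * pi * (1 - 1)"
    by (intro tendsto_intros T)
  ultimately have "(\<lambda>n. (LINT \<theta>|lborel. min (char_error (T n) \<theta>) (gauss_dominator \<theta>)) + 64 * pi * (1 - T n)) \<longlonglongrightarrow> 0 + 0"
    by (intro tendsto_add) simp_all
  then have lim: "(\<lambda>n. (LINT \<theta>|lborel. min (char_error (T n) \<theta>) (gauss_dominator \<theta>)) + 64 * pi * (1 - T n)) \<longlonglongrightarrow> 0"
    by simp
  show "(\<lambda>n. integral {- pi * sigma H2star (T n)..pi * sigma H2star (T n)} (char_error (T n))) \<longlonglongrightarrow> 0"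
  proof (rule tendsto_sandwich[OF _ _ tendsto_const lim])
    show "\<forall>\<^sub>F n in sequentially. 0 \<le> integral {- pi * sigma H2star (T n)..pi * sigma H2star (T n)} (char_error (T n))"
      by (intro always_eventually allI integral_nonneg integrable_continuous_real continuous_char_error T T')
        (simp add: char_error_def)
    show "\<forall>\<^sub>F n in sequentially. integral {- pi * sigma H2star (T n)..pi * sigma H2star (T n)} (char_error (T n))
        \<le> (LINT \<theta>|lborel. min (char_error (T n) \<theta>) (gauss_dominator \<theta>)) + 64 * pi * (1 - T n)"
      by (intro always_eventually allI integral_char_error_le T T')
  qed
qed simp

text \<open>\<open>H2star\<close> is defined t-adically, which by itself says nothing about values
  at real \<open>t\<close>; the conjuncts before \<open>strong_gaussian\<close> tie it to the
  analytic product and fix the endpoint at which the limit is taken.\<close>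

theorem theorem3p3:
  "(\<forall>t::real. \<bar>t\<bar> < 1 \<longrightarrow>
      eval_fps H2star t = 2 ^ 7 * (\<Prod>n. ((1 + t ^ (2 * n + 1)) / (1 - t ^ (2 * n + 1))) ^ 16)) \<and>
   (\<forall>n. fps_nth H2star n \<ge> 0) \<and>
   fps_conv_radius H2star = 1 \<and>
   strong_gaussian H2star"
proof -
  have r: "fps_conv_radius H2star = 1"
    unfolding H2star_eq by (simp add: fps_conv_radius_cmult_left fps_conv_radius_full_prod)
  have nn: "fps_nth H2star n > 0" for n
    using full_prod_nth_ge_1[of n] by (simp add: H2star_eq)
  have e: "eval_fps H2star t = 2 ^ 7 * (\<Prod>n. ((1 + t ^ (2 * n + 1)) / (1 - t ^ (2 * n + 1))) ^ 16)"
    if "\<bar>t\<bar> < 1" for t :: real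
    unfolding H2star_eq using that eval_full_prod_eq_prodinf[of t]
    by (subst eval_fps_mult) (auto simp: fps_conv_radius_full_prod one_ereal_def)
  have "to_radius H2star = at_left 1"
    by (simp add: to_radius_def r)
  moreover have "H2star \<noteq> 0"
    using nn[of 0] by force
  ultimately have "strong_gaussian H2star"
    using integral_char_error_tendsto sigma_pos nn
    by (auto simp: strong_gaussian_def r less_imp_le char_error_def[abs_def] one_ereal_def)
  with e r nn show ?thesis
    by (auto simp: less_imp_le)
qed

end
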